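(* For every positive integer $n$ there exists a finite non-abelian simple group $G$ such that $\Gamma_{n+1}(G)$ is strongly connected but $\Gamma_n(G)$ is not strongly connected.
   Context: For elements $x,y$ of a group, $[x,y]=x^{-1}y^{-1}xy$, $[x,_0y]=x$ and $[x,_{i+1}y]=[[x,_iy],y]$ for $i\ge 0$. For a finite group $G$ and a positive integer $n$, let $I_n(G)=\{g\in G : [g,_nx]=1 \text{ and } [x,_ng]=1 \text{ for all } x\in G\}$. The $n$-th Engel graph $\Gamma_n(G)$ is the directed graph with vertex set $G\setminus I_n(G)$ in which $(x,y)$ is an arc if and only if $[x,_ny]=1$. A directed graph is strongly connected if for any two vertices there is a directed path from the first to the second. *)

theory Defs
  imports "HOL-Algebra.SimpleGroups" "Graph_Theory.Digraph_Component"
begin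

(* Conventions differ between sources (Solvable_Groups uses x y x^-1 y^-1);
   here [x, y] = x^-1 y^-1 x y. *)
definition commutator :: "('a, 'b) monoid_scheme \<Rightarrow> 'a \<Rightarrow> 'a \<Rightarrow> 'a" where
  "commutator G x y = inv\<^bsub>G\<^esub> x \<otimes>\<^bsub>G\<^esub> inv\<^bsub>G\<^esub> y \<otimes>\<^bsub>G\<^esub> x \<otimes>\<^bsub>G\<^esub> y"

(* engel_commutator G n x y is the left-normed commutator [x, y, ..., y] with n copies of y. *)
primrec engel_commutator :: "('a, 'b) monoid_scheme \<Rightarrow> nat \<Rightarrow> 'a \<Rightarrow> 'a \<Rightarrow> 'a" where
  "engel_commutator G 0 x y = x"
| "engel_commutator G (Suc i) x y = commutator G (engel_commutator G i x y) y"

definition engel_universal :: "('a, 'b) monoid_scheme \<Rightarrow> nat \<Rightarrow> 'a set" where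
  "engel_universal G n =
    {g \<in> carrier G. \<forall>x \<in> carrier G.
       engel_commutator G n g x = \<one>\<^bsub>G\<^esub> \<and> engel_commutator G n x g = \<one>\<^bsub>G\<^esub>}"

(* For n \<ge> 1 every vertex carries a loop, since [x, x] = 1;
   loops do not affect strong connectedness. *)
definition engel_graph :: "('a, 'b) monoid_scheme \<Rightarrow> nat \<Rightarrow> 'a pair_pre_digraph" where
  "engel_graph G n =
    \<lparr> pverts = carrier G - engel_universal G n,
      parcs = {(x, y). x \<in> carrier G - engel_universal G n \<and> y \<in> carrier G - engel_universal G n \<and>
                       engel_commutator G n x y = \<one>\<^bsub>G\<^esub>} \<rparr>"

(* Unlike strongly_connected of Graph_Theory, which demands a vertex, the empty digraph
   counts as strongly connected; hence a digraph violating this predicate really has two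
   vertices not joined by a directed path. *)
definition strongly_connected_digraph :: "('a, 'b) pre_digraph \<Rightarrow> bool" where
  "strongly_connected_digraph D \<longleftrightarrow> (\<forall>u \<in> verts D. \<forall>v \<in> verts D. u \<rightarrow>\<^sup>*\<^bsub>D\<^esub> v)"

lemma strongly_connected_iff_strongly_connected_digraph:
  "strongly_connected D \<longleftrightarrow> verts D \<noteq> {} \<and> strongly_connected_digraph D"
  by (simp add: strongly_connected_def strongly_connected_digraph_def)

end

(*
Take G = PSL(2, p) for a prime p = 3 (mod 4) with 2^(n+1) exactly dividing p + 1.

For an involution y and i >= 1, the element [x,_i y] is a 2^(i-1)-th power of y^x y up to sign of
the exponent, so there is an arc from x to y at level i iff the order of y^x y divides 2^(i-1).
If x is unipotent, the trace of y^x y is -(P^2 + 2), up to sign, for some P in F_p, and since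
p = 3 (mod 4) such an element of 2-power order always has order exactly 2^n. A trace computation
shows that no other element outside the unipotent group of x satisfies [x,_i y] = 1 for any i.
Hence at level n no arc leaves the unipotent group. At level n + 1 there are arcs from it to every
involution, and all other elements are easily joined: elements with eigenvalues in F_p through a
Borel subgroup containing them, the others through the involution of their torus.

The Lucas-type sequence v_1 = 11, v_(i+1) = v_i^2 - 2 provides the prime: v_n = 3 (mod 4) has a
prime factor p = 3 (mod 4), and p | v_n forces 2^(n+1) to divide p + 1 exactly. (With indices
starting from 0, v_n is the value at k = n - 1 below.) Dirichlet's theorem is thus not needed.
*)

theory Submission
  imports Defs "HOL-Number_Theory.Number_Theory" "HOL-Library.Countable"
begin

section \<open>Integral 2 by 2 matrices\<close>

text \<open>The obstacle is uniformity in P: one level has to block all arcs from a unipotent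
  element to involutions, although the traces P^2 + 2 vary. Now P^2 + 2 is the trace of the square
  of the companion matrix of X^2 - P X - 1, whose determinant is -1 for every P. If P^2 + 4 is a
  non-residue, Frobenius sends an eigenvalue z to -1/z, so the (p + 1)-th power of that matrix is -1
  whatever P is, and the power of 2 in p + 1 alone decides after how many squarings a trace can
  vanish. If P^2 + 4 is a square, no number of squarings produces trace 0. Elements of the field are
  represented by integers modulo \<open>p\<close>: matrix identities become polynomial identities
  over the integers, and a matrix known only modulo \<open>p\<close> is lifted to determinant 1
  where an actual vertex is required.\<close>

datatype mat2 = Mat (e11: int) (e12: int) (e21: int) (e22: int)

instance mat2 :: countable
  by countable_datatype

instantiation mat2 :: ring_1
begin

definition "0 = Mat 0 0 0 0"
definition "1 = Mat 1 0 0 1"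
definition "A + B = Mat (e11 A + e11 B) (e12 A + e12 B) (e21 A + e21 B) (e22 A + e22 B)"
definition "A - B = Mat (e11 A - e11 B) (e12 A - e12 B) (e21 A - e21 B) (e22 A - e22 B)"
definition "- A = Mat (- e11 A) (- e12 A) (- e21 A) (- e22 A)"
definition "A * B =
  Mat (e11 A * e11 B + e12 A * e21 B) (e11 A * e12 B + e12 A * e22 B)
      (e21 A * e11 B + e22 A * e21 B) (e21 A * e12 B + e22 A * e22 B)"

lemmas mat2_arith =
  zero_mat2_def one_mat2_def plus_mat2_def minus_mat2_def uminus_mat2_def times_mat2_def

instance
  by standard (auto simp: mat2_arith algebra_simps)

end

lemma of_int_mat2: "of_int k = Mat k 0 0 k"
proof -
  have *: "of_nat n = Mat (int n) 0 0 (int n)" for n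
    by (induction n) (auto simp: mat2_arith)
  show ?thesis
    by (cases k rule: int_cases2) (auto simp: * mat2_arith)
qed

primrec det :: "mat2 \<Rightarrow> int" where "det (Mat a b c d) = a * d - b * c"
primrec tr :: "mat2 \<Rightarrow> int" where "tr (Mat a b c d) = a + d"
primrec adj :: "mat2 \<Rightarrow> mat2" where "adj (Mat a b c d) = Mat d (- b) (- c) a"

lemma Mat_arith [simp]:
  "Mat a b c d + Mat a' b' c' d' = Mat (a + a') (b + b') (c + c') (d + d')"
  "Mat a b c d - Mat a' b' c' d' = Mat (a - a') (b - b') (c - c') (d - d')"
  "Mat a b c d * Mat a' b' c' d' =
     Mat (a * a' + b * c') (a * b' + b * d') (c * a' + d * c') (c * b' + d * d')"
  "- Mat a b c d = Mat (- a) (- b) (- c) (- d)"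
  by (simp_all add: mat2_arith)

lemma det_mult: "det (A * B) = det A * det B"
  by (cases A; cases B) (simp add: algebra_simps)

lemma det_simps [simp]: "det 1 = 1" "det (- A) = det A" "det (adj A) = det A"
  by (simp add: mat2_arith, (cases A, simp)+)

lemma det_power: "det (A ^ n) = det A ^ n"
  by (induction n) (simp_all add: det_mult)

lemma tr_simps [simp]: "tr 1 = 2" "tr (- A) = - tr A" "tr (adj A) = tr A"
  by (simp add: mat2_arith, (cases A, simp)+)

lemma tr_commute: "tr (A * B) = tr (B * A)"
  by (cases A; cases B) (simp add: algebra_simps)

lemma adj_simps [simp]: "adj 1 = 1" "adj (- A) = - adj A" "adj (adj A) = A"
  by (simp add: mat2_arith, (cases A, simp)+)

lemma adj_mult: "adj (A * B) = adj B * adj A"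
  by (cases A; cases B) (simp add: algebra_simps)

lemma adj_left: "adj A * A = of_int (det A)"
  by (cases A) (simp add: of_int_mat2 algebra_simps)

lemma adj_right: "A * adj A = of_int (det A)"
  by (cases A) (simp add: of_int_mat2 algebra_simps)

section \<open>Congruence of matrices modulo p\<close>

definition mcong :: "int \<Rightarrow> mat2 \<Rightarrow> mat2 \<Rightarrow> bool" where
  "mcong p A B \<longleftrightarrow> [e11 A = e11 B] (mod p) \<and> [e12 A = e12 B] (mod p) \<and>
     [e21 A = e21 B] (mod p) \<and> [e22 A = e22 B] (mod p)"

lemma mcong_refl [simp, intro]: "mcong p A A"
  by (simp add: mcong_def)

lemma mcong_sym: "mcong p A B \<Longrightarrow> mcong p B A"
  by (simp add: mcong_def cong_sym)

lemma mcong_trans [trans]: "mcong p A B \<Longrightarrow> mcong p B C \<Longrightarrow> mcong p A C"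
  unfolding mcong_def by (blast intro: cong_trans)

lemma mcong_add: "mcong p A A' \<Longrightarrow> mcong p B B' \<Longrightarrow> mcong p (A + B) (A' + B')"
  by (simp add: mcong_def plus_mat2_def cong_add)

lemma mcong_mult: "mcong p A A' \<Longrightarrow> mcong p B B' \<Longrightarrow> mcong p (A * B) (A' * B')"
  by (simp add: mcong_def times_mat2_def cong_add cong_mult)

lemma mcong_minus: "mcong p A A' \<Longrightarrow> mcong p (- A) (- A')"
  by (simp add: mcong_def uminus_mat2_def cong_minus_minus_iff)

lemma mcong_adj: "mcong p A A' \<Longrightarrow> mcong p (adj A) (adj A')"
  by (cases A; cases A') (simp add: mcong_def cong_minus_minus_iff)

lemma mcong_tr: "mcong p A A' \<Longrightarrow> [tr A = tr A'] (mod p)"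
  by (cases A; cases A') (simp add: mcong_def cong_add)

lemma mcong_power: "mcong p A A' \<Longrightarrow> mcong p (A ^ n) (A' ^ n)"
  by (induction n) (auto intro: mcong_mult)

text \<open>Matrices do not commute in general, so the binomial theorem is proved for a single
  commuting pair; it is applied to a matrix plus a scalar.\<close>

lemma binomial_commuting:
  fixes x y :: "'a::ring_1"
  assumes "x * y = y * x"
  shows "(x + y) ^ n = (\<Sum>k\<le>n. of_nat (n choose k) * (x ^ k * y ^ (n - k)))"
proof (induction n)
  case 0
  show ?case by simp
next
  case (Suc n)
  let ?f = "\<lambda>k. x ^ k * y ^ (Suc n - k)"
  have xy: "y * x ^ k = x ^ k * y" for k
    using assms by (metis power_commuting_commutes)
  have 1: "x * (of_nat (n choose k) * (x ^ k * y ^ (n - k))) = of_nat (n choose k) * ?f (Suc k)" for k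
    by (simp add: mult_of_nat_commute [symmetric] mult.assoc) (simp add: mult.assoc mult_of_nat_commute)
  have 2: "y * (of_nat (n choose k) * (x ^ k * y ^ (n - k))) = of_nat (n choose k) * ?f k"
    if "k \<le> n" for k
  proof -
    have "y * (of_nat (n choose k) * (x ^ k * y ^ (n - k))) =
          of_nat (n choose k) * (y * x ^ k * y ^ (n - k))"
      by (metis mult.assoc mult_of_nat_commute)
    also have "\<dots> = of_nat (n choose k) * ?f k"
      using that by (simp add: xy mult.assoc Suc_diff_le)
    finally show ?thesis .
  qed
  have "(x + y) ^ Suc n = x * (\<Sum>k\<le>n. of_nat (n choose k) * (x ^ k * y ^ (n - k)))
        + y * (\<Sum>k\<le>n. of_nat (n choose k) * (x ^ k * y ^ (n - k)))"
    by (simp add: Suc distrib_right)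
  also have "\<dots> = (\<Sum>k\<le>n. of_nat (n choose k) * ?f (Suc k)) + (\<Sum>k\<le>n. of_nat (n choose k) * ?f k)"
    by (simp add: sum_distrib_left 1 2 del: power_Suc)
  also have "(\<Sum>k\<le>n. of_nat (n choose k) * ?f k) = (\<Sum>k\<le>Suc n. of_nat (n choose k) * ?f k)"
    by (simp add: binomial_eq_0)
  also have "\<dots> = ?f 0 + (\<Sum>k\<le>n. of_nat (n choose Suc k) * ?f (Suc k))"
    by (subst sum.atMost_Suc_shift) simp
  also have "(\<Sum>k\<le>n. of_nat (n choose k) * ?f (Suc k)) + \<dots> =
     ?f 0 + (\<Sum>k\<le>n. of_nat (Suc n choose Suc k) * ?f (Suc k))"
    by (simp add: sum.distrib distrib_right algebra_simps del: diff_Suc_Suc power_Suc)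
  also have "\<dots> = (\<Sum>k\<le>Suc n. of_nat (Suc n choose k) * ?f k)"
    by (subst sum.atMost_Suc_shift) simp
  finally show ?case .
qed


section \<open>Iterated traces and the power of 2 dividing p + 1\<close>

text \<open>If t = z + 1/z, the value is z^(2^k) + z^(-2^k): the trace of the 2^k-th power of a
  matrix of determinant 1 and trace t. A zero at \<open>k\<close> modulo an odd prime means order
  exactly 2^(k+1) up to sign.\<close>

primrec trace_pow2 :: "nat \<Rightarrow> int \<Rightarrow> int" where
  "trace_pow2 0 t = t"
| "trace_pow2 (Suc k) t = (trace_pow2 k t)\<^sup>2 - 2"

lemma trace_pow2_cong: "[s = t] (mod p) \<Longrightarrow> [trace_pow2 k s = trace_pow2 k t] (mod p)"
  by (induction k) (auto intro!: cong_diff cong_pow)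

lemma square_eq: "A * A = of_int (tr A) * A - of_int (det A)"
  by (cases A) (simp add: of_int_mat2 algebra_simps)

lemma tr_square: "tr (A * A) = (tr A)\<^sup>2 - 2 * det A"
  by (cases A) (simp add: power2_eq_square algebra_simps)

lemma tr_pow2: "det A = 1 \<Longrightarrow> tr (A ^ 2 ^ k) = trace_pow2 k (tr A)"
proof (induction k)
  case (Suc k)
  have "A ^ 2 ^ Suc k = A ^ 2 ^ k * A ^ 2 ^ k"
    by (simp add: mult_2 power_add)
  moreover have "det (A ^ 2 ^ k) = 1"
    by (simp add: det_power Suc.prems)
  ultimately show ?case
    using Suc by (simp add: tr_square)
qed simp

text \<open>Cayley-Hamilton. Because of this, trace 0 serves below as the description of the
  involutions of PSL(2, p).\<close>

lemma square_traceless: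
  assumes "det A = 1" "[tr A = 0] (mod p)"
  shows "mcong p (A * A) (- 1)"
proof -
  have "mcong p (of_int (tr A)) 0"
    using assms(2) by (simp add: of_int_mat2 mcong_def zero_mat2_def)
  from mcong_add[OF mcong_mult[OF this mcong_refl] mcong_refl[of p "- 1"], of A]
  show ?thesis by (simp add: square_eq assms)
qed

text \<open>Otherwise x/y would be a square root of -1 modulo \<open>p\<close>, which Euler's
  criterion forbids because (p - 1)/2 is odd.\<close>

lemma sum_two_squares_dvd:
  fixes p :: int
  assumes p: "prime p" "p mod 4 = 3" and xy: "p dvd x\<^sup>2 + y\<^sup>2"
  shows "p dvd y"
proof (rule ccontr)
  assume y: "\<not> p dvd y"
  define q where "q = nat p"
  have q: "p = int q" "prime q"
    using p prime_gt_0_int[of p] by (auto simp: q_def)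
  then have "q mod 4 = 3"
    using p(2) by presburger
  have odd: "odd ((q - 1) div 2)" and q2: "q > 2"
    using \<open>q mod 4 = 3\<close> by presburger+
  obtain z where z: "[y * z = 1] (mod p)"
    using y p(1) cong_solve_coprime_int[of y p] prime_imp_coprime[of p y]
    by (auto simp: coprime_commute)
  have "[(x * z)\<^sup>2 + (y * z)\<^sup>2 = 0] (mod p)"
  proof -
    have "(x * z)\<^sup>2 + (y * z)\<^sup>2 = (x\<^sup>2 + y\<^sup>2) * z\<^sup>2"
      by (simp add: power_mult_distrib distrib_right)
    then show ?thesis
      using xy by (simp add: cong_0_iff)
  qed
  moreover have "[(y * z)\<^sup>2 = 1] (mod p)"
    using cong_pow[OF z, of 2] by simp
  ultimately have "[(x * z)\<^sup>2 + 1 = 0] (mod p)"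
    by (meson cong_add_lcancel cong_sym cong_trans)
  then have "[(x * z)\<^sup>2 = -1] (mod p)"
    by (simp add: cong_iff_dvd_diff)
  then have "Legendre (-1) p \<in> {0, 1}"
    by (auto simp: Legendre_def QuadRes_def)
  moreover have "[Legendre (-1) p = -1] (mod p)"
    using euler_criterion[OF q(2) q2, of "-1"] odd by (simp add: q(1))
  moreover have "\<not> [0 = -1] (mod p)" "\<not> [1 = -1] (mod p)"
    using q2 q(1) by (auto simp: cong_iff_dvd_diff dest: zdvd_imp_le)
  ultimately show False by auto
qed

text \<open>
  If $t - 2$ and $t + 2$ are squares, then so are $(t^2 - 2) - 2$ and $(t^2 - 2) + 2$. Hence if
  $P^2 + 4$ were a square, a zero of the iteration started at $P^2 + 2$ would make both $2$ and
  $-2$ squares.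
\<close>

lemma trace_pow2_plus_minus_two_squares:
  "[t - 2 = x\<^sup>2] (mod p) \<Longrightarrow> [t + 2 = y\<^sup>2] (mod p) \<Longrightarrow>
     \<exists>x y. [trace_pow2 k t - 2 = x\<^sup>2] (mod p) \<and> [trace_pow2 k t + 2 = y\<^sup>2] (mod p)"
proof (induction k)
  case (Suc k)
  then obtain x y where "[trace_pow2 k t - 2 = x\<^sup>2] (mod p)" "[trace_pow2 k t + 2 = y\<^sup>2] (mod p)"
    by auto
  from cong_mult[OF this] have "[trace_pow2 (Suc k) t - 2 = (x * y)\<^sup>2] (mod p)"
    by (simp add: algebra_simps power2_eq_square)
  moreover have "[trace_pow2 (Suc k) t + 2 = (trace_pow2 k t)\<^sup>2] (mod p)"
    by simp
  ultimately show ?case by blast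
qed auto

lemma trace_pow2_zero_nonresidue:
  fixes p :: int
  assumes p: "prime p" "p mod 4 = 3" and zero: "p dvd trace_pow2 k (P\<^sup>2 + 2)"
  shows "\<not> [P\<^sup>2 + 4 = r\<^sup>2] (mod p)"
proof
  assume "[P\<^sup>2 + 4 = r\<^sup>2] (mod p)"
  then have "[P\<^sup>2 + 2 + 2 = r\<^sup>2] (mod p)"
    by (simp add: add.assoc)
  moreover have "[P\<^sup>2 + 2 - 2 = P\<^sup>2] (mod p)"
    by simp
  ultimately obtain x y where xy:
    "[trace_pow2 k (P\<^sup>2 + 2) - 2 = x\<^sup>2] (mod p)" "[trace_pow2 k (P\<^sup>2 + 2) + 2 = y\<^sup>2] (mod p)"
    using trace_pow2_plus_minus_two_squares by blast
  have "p dvd x\<^sup>2 + y\<^sup>2"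
  proof -
    have "[2 * trace_pow2 k (P\<^sup>2 + 2) = x\<^sup>2 + y\<^sup>2] (mod p)"
      using cong_add[OF xy] by simp
    then show ?thesis
      using zero by (meson cong_dvd_iff dvd_mult)
  qed
  then have "p dvd y"
    using sum_two_squares_dvd[OF p] by blast
  then have "p dvd trace_pow2 k (P\<^sup>2 + 2) + 2"
    using xy(2) by (simp add: cong_dvd_iff power2_eq_square)
  then have "p dvd 2"
    using zero by (simp add: dvd_add_right_iff)
  then have "p \<le> 2"
    by (simp add: zdvd_imp_le)
  then show False
    using p(2) prime_gt_0_int[OF p(1)] by presburger
qed

lemma of_int_mcong: "[a = b] (mod p) \<Longrightarrow> mcong p (of_int a) (of_int b)"
  by (simp add: mcong_def of_int_mat2)

lemma mcong_sum_eq_0: "(\<And>i. i \<in> I \<Longrightarrow> mcong p (f i) 0) \<Longrightarrow> mcong p (sum f I) 0"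
  by (induction I rule: infinite_finite_induct) (auto intro: mcong_add[of p _ 0 _ 0, simplified])

lemma of_int_mult_power: "(of_int a * (M::'a::ring_1)) ^ n = of_int (a ^ n) * M ^ n"
proof (induction n)
  case (Suc n)
  have "(of_int a * M) ^ Suc n = of_int a * (M * of_int (a ^ n)) * M ^ n"
    by (simp only: power_Suc Suc mult.assoc)
  also have "M * of_int (a ^ n) = of_int (a ^ n) * M"
    by (rule mult_of_int_commute [symmetric])
  also have "of_int a * (of_int (a ^ n) * M) * M ^ n = of_int (a ^ Suc n) * M ^ Suc n"
    by (simp only: of_int_mult power_Suc mult.assoc)
  finally show ?case .
qed simp

text \<open>The inner binomial coefficients vanish modulo the prime \<open>q\<close>.\<close>

lemma frobenius_scalar_add:
  assumes q: "prime (q::nat)"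
  shows "mcong q ((E + of_int P) ^ q) (E ^ q + of_int P ^ q)"
proof -
  let ?f = "\<lambda>k. of_nat (q choose k) * (E ^ k * of_int P ^ (q - k))"
  have "(E + of_int P) ^ q = sum ?f {..q}"
    by (rule binomial_commuting) (simp add: mult_of_int_commute)
  also have "{..q} = insert 0 (insert q {1..<q})"
    using prime_gt_0_nat[OF q] by auto
  also have "sum ?f \<dots> = (E ^ q + of_int P ^ q) + sum ?f {1..<q}"
    using prime_gt_0_nat[OF q] by (simp add: add_ac)
  finally have eq: "(E + of_int P) ^ q = (E ^ q + of_int P ^ q) + sum ?f {1..<q}" .
  have *: "mcong q (?f k) 0" if "k \<in> {1..<q}" for k
  proof -
    have "q dvd (q choose k)"
      using that q by (auto intro: dvd_choose_prime)
    then have "[int (q choose k) = 0] (mod int q)"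
      by (simp add: cong_0_iff)
    from mcong_mult[OF of_int_mcong[OF this] mcong_refl]
    show ?thesis by simp
  qed
  have "mcong q (sum ?f {1..<q}) 0"
    by (rule mcong_sum_eq_0) (rule *)
  from mcong_add[OF mcong_refl [of q "E ^ q + of_int P ^ q"] this]
  show ?thesis
    unfolding eq by (simp only: add_0_right)
qed

lemma mcong_cancel:
  assumes "prime p" "\<not> p dvd a" "mcong p (of_int a * A) (of_int a * B)"
  shows "mcong p A B"
proof -
  have "coprime a p"
    using prime_imp_coprime[OF assms(1,2)] by (simp add: coprime_commute)
  then show ?thesis
    using assms(3) by (simp add: mcong_def times_mat2_def of_int_mat2 cong_mult_lcancel)
qed

text \<open>
  Frobenius acts on $\mathbb F_p[M]$ as the nontrivial automorphism $M \mapsto P - M = - M^{-1}$.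
\<close>

lemma companion_power_prime:
  fixes P :: int
  defines "M \<equiv> Mat P 1 1 0"
  assumes q: "prime (q::nat)" "q > 2" and nonres: "\<And>r. \<not> [P\<^sup>2 + 4 = r\<^sup>2] (mod int q)"
  shows "mcong q (M ^ (q + 1)) (- 1)"
proof -
  \<comment> \<open>Completing the square: \<open>E\<close> is 2 M - P, a square root of the
    discriminant P^2 + 4. As the latter is a non-residue, Euler's criterion gives E^q = -E.\<close>
  define E where "E = Mat P 2 2 (- P)"
  define h where "h = (q - 1) div 2"
  have "odd q"
    using q prime_odd_nat by blast
  then have q_h: "q = Suc (2 * h)"
    by (auto simp: h_def elim: oddE)
  have EM: "E + of_int P = of_int 2 * M" "- E + of_int P = of_int 2 * (of_int P - M)"
    by (simp_all add: E_def M_def of_int_mat2)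
  have "E ^ 2 = of_int (P\<^sup>2 + 4)"
    by (simp add: E_def of_int_mat2 power2_eq_square)
  then have "E ^ q = of_int ((P\<^sup>2 + 4) ^ h) * E"
    by (simp only: q_h power_Suc2 power_mult of_int_power)
  moreover have "[(P\<^sup>2 + 4) ^ h = - 1] (mod int q)"
  proof -
    have "Legendre (P\<^sup>2 + 4) q = - 1"
      using nonres[of 0] nonres unfolding Legendre_def QuadRes_def by (auto intro: cong_sym)
    then show ?thesis
      using euler_criterion[OF q, of "P\<^sup>2 + 4"] by (simp add: h_def cong_sym)
  qed
  ultimately have "mcong q (E ^ q) (- E)"
    using mcong_mult[OF of_int_mcong mcong_refl, of "(P\<^sup>2 + 4) ^ h" "- 1" "int q" E] by simp
  moreover have fermat: "[a ^ q = a] (mod int q)" for a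
  proof -
    have "[a * (a ^ h * a ^ h) = a * (Legendre a q * Legendre a q)] (mod q)"
      using euler_criterion[OF q, of a] unfolding h_def
      by (intro cong_mult cong_refl) (simp_all add: cong_sym)
    also have "[a * (Legendre a q * Legendre a q) = a] (mod q)"
      by (simp add: Legendre_def cong_sym)
    also have "a * (a ^ h * a ^ h) = a ^ q"
      by (simp add: q_h mult_2 power_add)
    finally show ?thesis .
  qed
  ultimately have "mcong q (E ^ q + of_int P ^ q) (- E + of_int P)"
    by (metis mcong_add of_int_mcong of_int_power)
  from mcong_trans[OF frobenius_scalar_add[OF q(1)] this]
  have "mcong q ((of_int 2 * M) ^ q) (of_int 2 * (of_int P - M))"
    by (simp only: EM)
  then have "mcong q (of_int (2 ^ q) * M ^ q) (of_int 2 * (of_int P - M))"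
    by (simp only: of_int_mult_power)
  moreover have "mcong q (of_int 2 * M ^ q) (of_int (2 ^ q) * M ^ q)"
    by (intro mcong_mult of_int_mcong mcong_refl cong_sym[OF fermat])
  ultimately have "mcong q (of_int 2 * M ^ q) (of_int 2 * (of_int P - M))"
    by (blast intro: mcong_trans)
  moreover have "\<not> int q dvd 2"
    using q(2) by (auto dest: zdvd_imp_le)
  ultimately have "mcong q (M ^ q) (of_int P - M)"
    using q(1) by (auto intro: mcong_cancel [of "int q" 2])
  then have "mcong q (M ^ (q + 1)) ((of_int P - M) * M)"
    using mcong_mult[OF _ mcong_refl] by (simp add: power_Suc2 del: power_Suc)
  also have "(of_int P - M) * M = - 1"
    by (simp add: M_def of_int_mat2 one_mat2_def algebra_simps)
  finally show ?thesis .
qed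

text \<open>
  With $M$ the companion matrix of $X^2 - P X - 1$, both $M^{p+1}$ and $M^{2^{k+2}}$ equal $-1$.
\<close>

lemma trace_pow2_zero_valuation:
  fixes p :: int
  assumes p: "prime p" "p mod 4 = 3" and zero: "p dvd trace_pow2 k (P\<^sup>2 + 2)"
  shows "\<exists>r. odd r \<and> nat p + 1 = 2 ^ (k + 2) * r"
proof -
  define q where "q = nat p"
  have q: "p = int q" "prime q"
    using p prime_gt_0_int[of p] by (auto simp: q_def)
  then have "q > 2"
    using p(2) by presburger
  define M where "M = Mat P 1 1 0"
  have 1: "mcong p (M ^ (q + 1)) (- 1)"
    unfolding M_def q(1)
    by (rule companion_power_prime[OF q(2) \<open>q > 2\<close>])
       (use trace_pow2_zero_nonresidue[OF p zero] in \<open>simp add: q(1)\<close>)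
  have 2: "mcong p (M ^ 2 ^ (k + 2)) (- 1)"
  proof -
    \<comment> \<open>\<open>M\<close> itself has determinant -1, so the trace recursion starts from
      its square, of trace P^2 + 2.\<close>
    have "det ((M ^ 2) ^ 2 ^ k) = 1"
      by (simp add: M_def det_power)
    moreover have "det (M ^ 2) = 1" "tr (M ^ 2) = P\<^sup>2 + 2"
      by (simp_all add: M_def power2_eq_square)
    then have "tr ((M ^ 2) ^ 2 ^ k) = trace_pow2 k (P\<^sup>2 + 2)"
      by (simp only: tr_pow2)
    ultimately have "mcong p ((M ^ 2) ^ 2 ^ k * (M ^ 2) ^ 2 ^ k) (- 1)"
      using zero by (intro square_traceless) (simp_all add: cong_0_iff)
    then show ?thesis
      by (simp flip: power_mult power_add)
  qed
  have 3: "\<not> mcong p 1 (- 1)"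
    using \<open>q > 2\<close> unfolding q(1)
    by (auto simp: mcong_def one_mat2_def cong_iff_dvd_diff dest: zdvd_imp_le)
  \<comment> \<open>If \<open>e\<close> exceeded \<open>k + 2\<close>, then M^(p+1) would be an even
    power of M^(2^(k+2)), hence 1; if \<open>e\<close> were smaller, the odd power of M^(2^(k+2))
    with exponent \<open>r\<close> would be an even power of M^(p+1).\<close>
  obtain e r where er: "odd r" "q + 1 = 2 ^ e * r"
    by (rule multiplicity_decompose'[of "q + 1" "2::nat"]) (auto intro: that)
  have "\<not> e > k + 2"
  proof
    assume "e > k + 2"
    then have "2 ^ e = (2::nat) ^ (k + 2) * (2 * 2 ^ (e - k - 3))"
      by (simp flip: power_add power_Suc)
    then have "M ^ (q + 1) = (M ^ 2 ^ (k + 2)) ^ (2 * (2 ^ (e - k - 3) * r))"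
      using er(2) by (simp add: mult_ac flip: power_mult)
    then have "mcong p (M ^ (q + 1)) 1"
      using mcong_power[OF 2, of "2 * (2 ^ (e - k - 3) * r)"] by simp
    then show False
      using 1 3 mcong_sym mcong_trans by blast
  qed
  moreover have "\<not> e < k + 2"
  proof
    assume "e < k + 2"
    then have "(2::nat) ^ (k + 2) = 2 ^ e * (2 * 2 ^ (k + 1 - e))"
      by (simp flip: power_add power_Suc)
    then have "(M ^ 2 ^ (k + 2)) ^ r = (M ^ (q + 1)) ^ (2 * 2 ^ (k + 1 - e))"
      using er(2) by (simp add: mult_ac flip: power_mult)
    then have "mcong p ((M ^ 2 ^ (k + 2)) ^ r) 1"
      using mcong_power[OF 1, of "2 * 2 ^ (k + 1 - e)"] by simp
    moreover have "mcong p ((M ^ 2 ^ (k + 2)) ^ r) (- 1)"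
      using mcong_power[OF 2, of r] er(1) by simp
    ultimately show False
      using 3 mcong_sym mcong_trans by blast
  qed
  ultimately show ?thesis
    using er by (auto simp: q_def)
qed

text \<open>Either index plus 2 is the exponent of 2 in p + 1, which does not depend on P or
  Q.\<close>

lemma trace_pow2_zero_unique:
  fixes p :: int
  assumes "prime p" "p mod 4 = 3" "p dvd trace_pow2 k (P\<^sup>2 + 2)" "p dvd trace_pow2 l (Q\<^sup>2 + 2)"
  shows "k = l"
proof -
  obtain r s where "odd r" "odd s" "(2::nat) ^ (k + 2) * r = 2 ^ (l + 2) * s"
    using trace_pow2_zero_valuation[OF assms(1,2,3)] trace_pow2_zero_valuation[OF assms(1,2,4)] by metis
  then have "multiplicity 2 ((2::nat) ^ (k + 2) * r) = k + 2"
    "multiplicity 2 ((2::nat) ^ (k + 2) * r) = l + 2"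
    by (auto intro!: multiplicity_decomposeI simp del: power_add)
  then show ?thesis by simp
qed

section \<open>A prime for each level\<close>

lemma exists_prime_factor_3_mod_4:
  fixes m :: int
  assumes "m > 0" "m mod 4 = 3"
  shows "\<exists>p. prime p \<and> p dvd m \<and> p mod 4 = 3"
proof (rule ccontr)
  assume *: "\<not> ?thesis"
  have "p mod 4 = 1" if "p \<in># prime_factorization m" for p
  proof -
    have p: "prime p" "p dvd m"
      using that by (auto dest: in_prime_factors_imp_prime in_prime_factors_imp_dvd)
    have "odd m"
      using assms(2) by presburger
    then have "odd p"
      using p(2) dvd_trans by blast
    moreover have "p mod 4 \<noteq> 3"
      using * p by blast
    ultimately show ?thesis by presburger
  qed
  moreover have "prod_mset N mod 4 = 1" if "\<forall>p\<in>#N. p mod 4 = 1" for N :: "int multiset"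
    using that by (induction N) (auto simp flip: mod_mult_right_eq)
  ultimately have "prod_mset (prime_factorization m) mod 4 = 1"
    by blast
  then show False
    using assms by (simp add: prod_mset_prime_factorization_int)
qed

text \<open>The starting value is $11 = P^2 + 2$ for $P = 3$, for which $p = 3$ never divides the iterates.\<close>

lemma trace_pow2_11: "trace_pow2 k 11 > 2 \<and> trace_pow2 k 11 mod 4 = 3 \<and> trace_pow2 k 11 mod 3 = 2"
proof (induction k)
  case (Suc k)
  let ?v = "trace_pow2 k 11"
  have "?v\<^sup>2 mod 4 = 3\<^sup>2 mod 4" "?v\<^sup>2 mod 3 = 2\<^sup>2 mod 3"
    using Suc by (metis power_mod)+
  then have "(?v\<^sup>2 - 2) mod 4 = 3" "(?v\<^sup>2 - 2) mod 3 = 2"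
    by (simp_all, presburger+)
  moreover have "3 * 3 \<le> ?v * ?v"
    using Suc by (intro mult_mono) auto
  ultimately show ?case
    by (simp add: power2_eq_square)
qed simp

text \<open>The smaller odd choice P = 1 would start at 3, whose only prime factor belongs to the
  non-simple group PSL(2, 3). Starting at 11, the iterates are 2 modulo 3, and 5 is excluded by its
  residue modulo 4.\<close>

lemma exists_suitable_prime:
  "\<exists>p::int. prime p \<and> p mod 4 = 3 \<and> p > 5 \<and> p dvd trace_pow2 k 11"
proof -
  obtain p where p: "prime p" "p dvd trace_pow2 k 11" "p mod 4 = 3"
    using exists_prime_factor_3_mod_4[of "trace_pow2 k 11"] trace_pow2_11[of k] by auto
  then have "p \<noteq> 3"
    using trace_pow2_11[of k] by auto
  then have "p > 5"
    using prime_gt_1_int[OF p(1)] p(3) by presburger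
  with p show ?thesis by blast
qed

section \<open>Traces of Engel words\<close>

text \<open>In determinant 1 \<open>adj\<close> is the inverse. Being polynomial in the entries, the
  word respects congruences also when the determinant is 1 only modulo \<open>p\<close>.\<close>

definition comm :: "mat2 \<Rightarrow> mat2 \<Rightarrow> mat2" where
  "comm A B = adj A * adj B * A * B"

primrec eng :: "nat \<Rightarrow> mat2 \<Rightarrow> mat2 \<Rightarrow> mat2" where
  "eng 0 A B = A"
| "eng (Suc k) A B = comm (eng k A B) B"

definition upper :: "int \<Rightarrow> mat2" where "upper x = Mat 1 x 0 1"
definition lower :: "int \<Rightarrow> mat2" where "lower x = Mat 1 0 x 1"

lemma det_upper [simp]: "det (upper x) = 1" and det_lower [simp]: "det (lower x) = 1"
  by (simp_all add: upper_def lower_def)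

lemma det_comm: "det A = 1 \<Longrightarrow> det B = 1 \<Longrightarrow> det (comm A B) = 1"
  by (simp add: comm_def det_mult)

lemma det_eng: "det A = 1 \<Longrightarrow> det B = 1 \<Longrightarrow> det (eng k A B) = 1"
  by (induction k) (auto simp: det_comm)

lemma adj_cancel:
  assumes "det A = 1"
  shows "adj A * A = 1" "A * adj A = 1" "adj A * (A * B) = B" "A * (adj A * B) = B"
  using assms by (simp_all add: adj_left adj_right flip: mult.assoc)

lemma tr_of_int_mult: "tr (of_int k * A) = k * tr A"
  by (cases A) (simp add: of_int_mat2 algebra_simps)

lemma tr_diff: "tr (A - B) = tr A - tr B"
  by (cases A; cases B) simp

text \<open>The Fricke identity. Homogenised with the determinants, it is a polynomial identity in
  the eight entries.\<close>

lemma tr_comm: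
  assumes "det A = 1" "det B = 1"
  shows "tr (comm A B) = (tr A)\<^sup>2 + (tr B)\<^sup>2 + (tr (A * B))\<^sup>2 - tr A * tr B * tr (A * B) - 2"
proof -
  have "tr (comm A B) = det B * (tr A)\<^sup>2 + det A * (tr B)\<^sup>2 + (tr (A * B))\<^sup>2
      - tr A * tr B * tr (A * B) - 2 * (det A * det B)"
    by (cases A; cases B) (simp add: comm_def power2_eq_square algebra_simps)
  then show ?thesis
    by (simp add: assms)
qed

lemma tr_comm_mult:
  assumes "det A = 1" "det B = 1"
  shows "tr (comm A B * B) = tr B * (tr (comm A B) - 1)"
proof -
  let ?C = "adj A * adj B * A"
  have "comm A B * B = ?C * (B * B)"
    by (simp add: comm_def mult.assoc)
  also have "\<dots> = of_int (tr B) * comm A B - ?C"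
    by (simp add: square_eq assms(2) comm_def right_diff_distrib mult.assoc)
       (metis mult.assoc mult_of_int_commute)
  finally have "tr (comm A B * B) = tr B * tr (comm A B) - tr ?C"
    by (simp only: tr_diff tr_of_int_mult)
  also have "tr ?C = tr B"
    using assms(1) by (metis tr_commute adj_cancel(4) mult.assoc tr_simps(3))
  finally show ?thesis
    by (simp add: algebra_simps)
qed

text \<open>The engine of the trace arguments: from the first commutator on, the trace t of an Engel
  word and \<open>tr B\<close> determine the next trace. For \<open>tr B = 0\<close> the recursion
  is t to t^2 - 2; for trace 2 or -2 it squares t - 2.\<close>

lemma tr_comm_comm:
  assumes "det A = 1" "det B = 1"
  shows "tr (comm (comm A B) B) - 2 = (tr (comm A B) - 2) * (tr (comm A B) + 2 - (tr B)\<^sup>2)"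
  by (simp add: tr_comm[OF det_comm[OF assms] assms(2)] tr_comm_mult[OF assms]
      power2_eq_square algebra_simps)

text \<open>The origin of the form P^2 + 2, with P = \<open>e21 Y * s\<close>: the trace minus 2 is
  a square.\<close>

lemma tr_comm_upper:
  assumes "det Y = 1"
  shows "tr (comm (upper s) Y) = (e21 Y * s)\<^sup>2 + 2"
    and "tr (comm Y (upper s)) = (e21 Y * s)\<^sup>2 + 2"
proof -
  have "tr (comm (upper s) Y) = (e21 Y * s)\<^sup>2 + 2 * det Y"
    "tr (comm Y (upper s)) = (e21 Y * s)\<^sup>2 + 2 * det Y"
    by (cases Y; simp add: comm_def upper_def power2_eq_square algebra_simps)+
  then show "tr (comm (upper s) Y) = (e21 Y * s)\<^sup>2 + 2"
    "tr (comm Y (upper s)) = (e21 Y * s)\<^sup>2 + 2"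
    by (simp_all add: assms)
qed

lemma mult_eq_swap_comm:
  assumes "det A = 1" "det B = 1"
  shows "B * A * comm A B = A * B"
  using assms by (simp add: comm_def mult.assoc adj_cancel)

text \<open>For matrices of determinant 1 this is equality of their images in PSL(2, p).\<close>

definition psim :: "int \<Rightarrow> mat2 \<Rightarrow> mat2 \<Rightarrow> bool" where
  "psim p A B \<longleftrightarrow> mcong p A B \<or> mcong p A (- B)"

lemma psim_refl [simp, intro]: "psim p A A"
  by (simp add: psim_def)

lemma psim_sym: "psim p A B \<Longrightarrow> psim p B A"
  unfolding psim_def
  by (metis mcong_sym mcong_minus minus_minus)

lemma psim_trans [trans]: "psim p A B \<Longrightarrow> psim p B C \<Longrightarrow> psim p A C"
  unfolding psim_def
  by (metis mcong_trans mcong_minus minus_minus)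

lemma mcong_imp_psim: "mcong p A B \<Longrightarrow> psim p A B"
  by (simp add: psim_def)

lemma psim_mult: "psim p A A' \<Longrightarrow> psim p B B' \<Longrightarrow> psim p (A * B) (A' * B')"
  unfolding psim_def
  by (elim disjE; drule (1) mcong_mult; simp)

lemma psim_adj: "psim p A A' \<Longrightarrow> psim p (adj A) (adj A')"
  unfolding psim_def using mcong_adj by fastforce

lemma psim_comm: "psim p A A' \<Longrightarrow> psim p B B' \<Longrightarrow> psim p (comm A B) (comm A' B')"
  by (simp add: comm_def psim_mult psim_adj)

lemma psim_eng: "psim p A A' \<Longrightarrow> psim p B B' \<Longrightarrow> psim p (eng k A B) (eng k A' B')"
  by (induction k) (auto intro: psim_comm)

lemma psim_tr: "psim p A 1 \<Longrightarrow> [tr A = 2] (mod p) \<or> [tr A = - 2] (mod p)"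
  unfolding psim_def using mcong_tr by fastforce

text \<open>The residue modulo 4 makes -1 a non-residue. The bound makes 2, 3 and 5 invertible; the
  simplicity proof divides by 15.\<close>

locale prime_3_mod_4 =
  fixes p :: int
  assumes prime: "prime p" and mod_4: "p mod 4 = 3" and gt_5: "p > 5"
begin

lemma p_dvd_mult [simp]: "p dvd a * b \<longleftrightarrow> p dvd a \<or> p dvd b"
  by (rule prime_dvd_mult_iff[OF prime])

lemma p_dvd_power2 [simp]: "p dvd a\<^sup>2 \<longleftrightarrow> p dvd a"
  by (simp add: power2_eq_square)

lemma not_dvd_small: "0 < a \<Longrightarrow> a < 6 \<Longrightarrow> \<not> p dvd a"
  using gt_5 by (auto dest: zdvd_imp_le)

lemma two_squares: "p dvd x\<^sup>2 + y\<^sup>2 \<Longrightarrow> p dvd x \<and> p dvd y"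
  using sum_two_squares_dvd[OF prime mod_4, of x y] sum_two_squares_dvd[OF prime mod_4, of y x]
  by (simp add: add.commute)

lemma dvd_halve: "p dvd 2 * x \<Longrightarrow> p dvd x"
  using not_dvd_small[of 2] by simp

lemma mcong_dvd:
  "mcong p (Mat a b c d) (Mat a' b' c' d') \<longleftrightarrow>
     p dvd a - a' \<and> p dvd b - b' \<and> p dvd c - c' \<and> p dvd d - d'"
  by (simp add: mcong_def cong_iff_dvd_diff)

text \<open>Backwards, t^2 - 2 = 2 means t = 2 or t = -2, and t^2 - 2 = -2 means t = 0. So a zero
  turns up, or the start P^2 + 2 is itself 2 or -2 and one of P^2, P^2 + 2^2 vanishes.\<close>

lemma trace_pow2_eq_pm_2:
  assumes "\<not> p dvd P" "[trace_pow2 k (P\<^sup>2 + 2) = 2] (mod p) \<or> [trace_pow2 k (P\<^sup>2 + 2) = - 2] (mod p)"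
  shows "\<exists>j<k. p dvd trace_pow2 j (P\<^sup>2 + 2)"
  using assms(2)
proof (induction k)
  case 0
  then have "p dvd P\<^sup>2 \<or> p dvd P\<^sup>2 + 2\<^sup>2"
    by (simp add: cong_iff_dvd_diff add.commute)
  then show ?case
    using assms(1) two_squares by (metis p_dvd_power2)
next
  case (Suc k)
  let ?v = "trace_pow2 k (P\<^sup>2 + 2)"
  have "p dvd ?v\<^sup>2 - 4 \<or> p dvd ?v\<^sup>2"
    using Suc.prems by (auto simp: cong_iff_dvd_diff)
  moreover have "?v\<^sup>2 - 4 = (?v - 2) * (?v + 2)"
    by (simp add: algebra_simps power2_eq_square)
  ultimately have "p dvd ?v - 2 \<or> p dvd ?v + 2 \<or> p dvd ?v"
    by (auto simp del: p_dvd_power2) (simp_all add: power2_eq_square)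
  then show ?case
    using Suc.IH less_Suc_eq by (auto simp: cong_iff_dvd_diff)
qed

lemma tr_eng_involution:
  assumes "det A = 1" "det Y = 1" "p dvd tr Y"
  shows "[tr (eng (Suc k) A Y) = trace_pow2 k (tr (comm A Y))] (mod p)"
proof (induction k)
  case (Suc k)
  let ?t = "tr (eng (Suc k) A Y)"
  have "tr (eng (Suc (Suc k)) A Y) - 2 = (?t - 2) * (?t + 2 - (tr Y)\<^sup>2)"
    using tr_comm_comm[OF det_eng[OF assms(1,2)] assms(2)] by simp
  then have "tr (eng (Suc (Suc k)) A Y) - (?t\<^sup>2 - 2) = tr Y * (tr Y * (2 - ?t))"
    by (simp add: algebra_simps power2_eq_square)
  then have "[tr (eng (Suc (Suc k)) A Y) = ?t\<^sup>2 - 2] (mod p)"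
    using assms(3) by (simp only: cong_iff_dvd_diff) simp
  also have "[?t\<^sup>2 - 2 = trace_pow2 (Suc k) (tr (comm A Y))] (mod p)"
    unfolding trace_pow2.simps by (intro cong_diff cong_pow Suc.IH cong_refl)
  finally show ?case .
qed simp

text \<open>The word with index j + 1 has the trace with index j. A trivial word with index
  \<open>k\<close> has trace 2 or -2, which requires a zero strictly before trace index k -
  1.\<close>

lemma eng_involution_nontrivial:
  assumes "det Y = 1" "p dvd tr Y" "\<not> p dvd e21 Y * s"
    and "\<And>j. Suc j < k \<Longrightarrow> \<not> p dvd trace_pow2 j ((e21 Y * s)\<^sup>2 + 2)"
  shows "\<not> psim p (eng k (upper s) Y) 1"
proof (cases k)
  case 0
  then show ?thesis
    using assms(3) by (auto simp: psim_def upper_def one_mat2_def mcong_dvd)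
next
  case (Suc m)
  show ?thesis
  proof
    assume "psim p (eng k (upper s) Y) 1"
    moreover have "[tr (eng k (upper s) Y) = trace_pow2 m ((e21 Y * s)\<^sup>2 + 2)] (mod p)"
      using tr_eng_involution[of "upper s" Y m] assms(1,2) Suc by (simp add: tr_comm_upper)
    ultimately have "[trace_pow2 m ((e21 Y * s)\<^sup>2 + 2) = 2] (mod p) \<or>
        [trace_pow2 m ((e21 Y * s)\<^sup>2 + 2) = - 2] (mod p)"
      using psim_tr cong_sym cong_trans by blast
    from trace_pow2_eq_pm_2[OF assms(3) this] show False
      using assms(4) Suc by auto
  qed
qed

text \<open>If the discriminant (tr Y)^2 - 4 is not 0, only \<open>Y\<close> and its conjugate
  \<open>adj Y\<close> in the algebra generated by \<open>Y\<close> share its characteristic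
  polynomial. In coordinates: the trace-free parts of \<open>W\<close> and \<open>Y\<close> are
  proportional with equal discriminants, so their lower left entries agree up to sign.\<close>

lemma commuting_same_trace:
  assumes "det W = 1" "det Y = 1" "tr W = tr Y" "\<not> p dvd e21 Y" "mcong p (W * Y) (Y * W)"
  shows "mcong p W Y \<or> mcong p W (adj Y) \<or> p dvd (tr Y)\<^sup>2 - 4"
proof -
  obtain a b c d where Y: "Y = Mat a b c d" by (cases Y)
  obtain x y z w where W: "W = Mat x y z w" by (cases W)
  have c: "\<not> p dvd c" and tr: "x + w = a + d"
    using assms by (simp_all add: Y W)
  have 1: "p dvd y * c - b * z" and 2: "p dvd z * (a - d) - c * (x - w)"
    using assms(5) by (simp_all add: Y W mcong_dvd algebra_simps)
  have dets: "(a - d)\<^sup>2 + 4 * b * c = (a + d)\<^sup>2 - 4" "(x - w)\<^sup>2 + 4 * y * z = (a + d)\<^sup>2 - 4"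
  proof -
    have "(a - d)\<^sup>2 + 4 * b * c = (a + d)\<^sup>2 - 4 * det Y"
      "(x - w)\<^sup>2 + 4 * y * z = (x + w)\<^sup>2 - 4 * det W"
      by (simp_all add: Y W power2_eq_square algebra_simps)
    then show "(a - d)\<^sup>2 + 4 * b * c = (a + d)\<^sup>2 - 4" "(x - w)\<^sup>2 + 4 * y * z = (a + d)\<^sup>2 - 4"
      by (simp_all add: assms(1,2) tr)
  qed
  have "(c - z) * (c + z) * ((a + d)\<^sup>2 - 4) =
      c\<^sup>2 * ((x - w)\<^sup>2 + 4 * y * z) - z\<^sup>2 * ((a - d)\<^sup>2 + 4 * b * c)"
    unfolding dets by (simp add: algebra_simps power2_eq_square)
  also have "\<dots> =
      4 * c * z * (y * c - b * z) - (z * (a - d) - c * (x - w)) * (z * (a - d) + c * (x - w))"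
    by (simp add: algebra_simps power2_eq_square)
  finally have "p dvd (c - z) * (c + z) * ((a + d)\<^sup>2 - 4)"
    using 1 2 by (metis dvd_diff dvd_mult dvd_mult2)
  then consider "p dvd z - c" | "p dvd z + c" | "p dvd (tr Y)\<^sup>2 - 4"
    by (auto simp: Y dvd_diff_commute add.commute)
  then show ?thesis
  proof cases
    case 1
    have "c * (a - d - (x - w)) = (z * (a - d) - c * (x - w)) - (z - c) * (a - d)"
      "c * (y - b) = (y * c - b * z) + b * (z - c)"
      by (simp_all add: algebra_simps)
    then have "p dvd c * (a - d - (x - w))" "p dvd c * (y - b)"
      using 1 \<open>p dvd y * c - b * z\<close> 2 by (metis dvd_diff dvd_add dvd_mult dvd_mult2)+
    then have "p dvd a - d - (x - w)" "p dvd y - b"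
      using c by auto
    moreover have "2 * (x - a) = - (a - d - (x - w))" "w - d = - (x - a)"
      using tr by simp_all
    ultimately have "p dvd 2 * (x - a)" "p dvd w - d \<longleftrightarrow> p dvd x - a" "p dvd y - b"
      by (simp_all only: dvd_minus_iff)
    from dvd_halve[OF this(1)] this(2,3) 1 show ?thesis
      by (simp add: Y W mcong_dvd)
  next
    case 2
    have "c * (a - d + (x - w)) = - (z * (a - d) - c * (x - w)) + (z + c) * (a - d)"
      "c * (y + b) = (y * c - b * z) + b * (z + c)"
      by (simp_all add: algebra_simps)
    then have "p dvd c * (a - d + (x - w))" "p dvd c * (y + b)"
      using 2 \<open>p dvd y * c - b * z\<close> \<open>p dvd z * (a - d) - c * (x - w)\<close>
      by (metis dvd_minus_iff dvd_add dvd_mult dvd_mult2)+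
    then have "p dvd a - d + (x - w)" "p dvd y + b"
      using c by auto
    moreover have "2 * (x - d) = a - d + (x - w)" "w - a = - (x - d)"
      using tr by simp_all
    ultimately have "p dvd 2 * (x - d)" "p dvd w - a \<longleftrightarrow> p dvd x - d" "p dvd y + b"
      by (simp_all only: dvd_minus_iff)
    from dvd_halve[OF this(1)] this(2,3) 2 show ?thesis
      by (simp add: Y W mcong_dvd)
  qed auto
qed

text \<open>The lower left entry of Y V - V adj Y is \<open>e21 Y * tr V\<close>.\<close>

lemma swap_to_adj_imp_traceless:
  assumes "mcong p (Y * V) (V * adj Y)" "\<not> p dvd e21 Y"
  shows "p dvd tr V"
proof -
  obtain a b c d where Y: "Y = Mat a b c d" by (cases Y)
  obtain x y z w where V: "V = Mat x y z w" by (cases V)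
  have "p dvd c * (x + w)"
    using assms(1) by (simp add: Y V mcong_dvd algebra_simps)
  then show ?thesis
    using assms(2) by (simp add: Y V)
qed

lemma tr_eng_parabolic:
  assumes "det A = 1" "det Y = 1" "p dvd (tr Y)\<^sup>2 - 4" "\<not> p dvd tr (comm A Y) - 2"
  shows "\<not> p dvd tr (eng (Suc k) A Y) - 2"
proof (induction k)
  case (Suc k)
  let ?t = "tr (eng (Suc k) A Y)"
  have "tr (eng (Suc (Suc k)) A Y) - 2 = (?t - 2) * (?t + 2 - (tr Y)\<^sup>2)"
    using tr_comm_comm[OF det_eng[OF assms(1,2)] assms(2)] by simp
  also have "\<dots> = (?t - 2)\<^sup>2 - (?t - 2) * ((tr Y)\<^sup>2 - 4)"
    by (simp add: algebra_simps power2_eq_square)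
  finally show ?case
    using Suc assms(3) by (metis diff_add_cancel dvd_add dvd_mult p_dvd_power2)
qed (use assms in simp)

text \<open>If [Q, Y] = -1, then \<open>Q\<close> conjugates \<open>Y\<close> into -Y, and comparing
  traces gives \<open>tr Y\<close> = 0.\<close>

lemma psim_comm_1_cases:
  assumes "det Q = 1" "det Y = 1" "psim p (comm Q Y) 1"
  shows "mcong p (Q * Y) (Y * Q) \<and> mcong p (comm Q Y) 1 \<or> p dvd tr Y"
proof -
  from assms(3) consider "mcong p (comm Q Y) 1" | "mcong p (comm Q Y) (- 1)"
    by (auto simp: psim_def)
  then show ?thesis
  proof cases
    case 1
    from mcong_mult[OF mcong_refl[of p "Y * Q"] this] show ?thesis
      using 1 by (simp add: mult_eq_swap_comm assms)
  next
    case 2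
    from mcong_mult[OF mcong_refl[of p "Y * Q"] this]
    have "mcong p (Q * Y) (- (Y * Q))"
      by (simp add: mult_eq_swap_comm assms)
    from mcong_tr[OF mcong_mult[OF mcong_refl[of p "adj Q"] this]]
    have "[tr Y = - tr (adj Q * (Y * Q))] (mod p)"
      by (simp add: adj_cancel assms)
    moreover have "tr (adj Q * (Y * Q)) = tr Y"
      by (metis tr_commute adj_cancel(4) mult.assoc assms(1))
    ultimately have "p dvd 2 * tr Y"
      by (simp add: cong_iff_dvd_diff)
    then show ?thesis
      using not_dvd_small[of 2] by simp
  qed
qed

text \<open>
  At the first trivial Engel word $[Q, Y]$ with $Q = [V, Y] = W^{-1} Y$, the matrices $Y$ and its
  conjugate $W$ commute, so that $W = Y$ (not the first), $W = Y^{-1}$, or $Y$ is parabolic. In the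
  second case $V$ has trace 0 and the trace recursion yields $(\mathrm{tr}\, Y)^2 = 0$; in the third
  the recursion for the trace minus 2 is squaring, so it never reaches 0.
\<close>

lemma eng_noninvolution_nontrivial:
  assumes Y: "det Y = 1" "\<not> p dvd tr Y" and c: "\<not> p dvd e21 Y * s"
  shows "\<not> psim p (eng k (upper s) Y) 1"
proof (induction k)
  case 0
  show ?case
    using c by (auto simp: psim_def upper_def one_mat2_def mcong_dvd)
next
  case (Suc k)
  show ?case
  proof
    assume *: "psim p (eng (Suc k) (upper s) Y) 1"
    define Q where "Q = eng k (upper s) Y"
    have Q: "det Q = 1"
      by (simp add: Q_def det_eng Y(1))
    have QY: "mcong p (Q * Y) (Y * Q)" "mcong p (comm Q Y) 1"
      using psim_comm_1_cases[OF Q Y(1)] * Y(2) by (auto simp: Q_def)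
    show False
    proof (cases k)
      case 0
      then show ?thesis
        using QY(1) c by (cases Y) (auto simp: Q_def upper_def mcong_dvd)
    next
      case (Suc m)
      define V where "V = eng m (upper s) Y"
      have V: "det V = 1"
        by (simp add: V_def det_eng Y(1))
      define W where "W = adj V * Y * V"
      have W: "det W = 1" "tr W = tr Y"
        using V Y(1) by (simp_all add: W_def det_mult mult.assoc)
           (metis tr_commute adj_cancel(4) mult.assoc)
      have Q_eq: "Q = adj W * Y"
        by (simp add: Q_def Suc comm_def W_def V_def adj_mult mult.assoc)
      have "mcong p (W * Y) (Y * W)"
      proof -
        have "mcong p (W * (Q * Y) * adj Y * W) (W * (Y * Q) * adj Y * W)"
          by (intro mcong_mult QY mcong_refl)
        then show ?thesis
          using W Y by (simp add: Q_eq mult.assoc adj_cancel mcong_sym)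
      qed
      then consider "mcong p W Y" | "mcong p W (adj Y)" | "p dvd (tr Y)\<^sup>2 - 4"
        using commuting_same_trace[OF W(1) Y(1) W(2)] c by auto
      then show ?thesis
      proof cases
        case 1
        then have "mcong p Q (adj Y * Y)"
          unfolding Q_eq by (intro mcong_mult mcong_adj mcong_refl)
        then show ?thesis
          using Suc.IH by (simp add: adj_cancel Y psim_def Q_def)
      next
        case 2
        have "mcong p (V * W) (V * adj Y)"
          by (intro mcong_mult mcong_refl 2)
        then have "mcong p (Y * V) (V * adj Y)"
          by (simp add: W_def mult.assoc adj_cancel V)
        then have trV: "p dvd tr V"
          using swap_to_adj_imp_traceless c by auto
        show ?thesis
        proof (cases m)
          case 0
          then show ?thesis
            using trV not_dvd_small[of 2] by (simp add: V_def upper_def)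
        next
          case (Suc i)
          let ?v = "tr V" and ?t = "tr Y"
          \<comment> \<open>Modulo \<open>p\<close>, with tr V = 0 the recursion gives tr Q = 2 t^2
            - 2, whereas Q = Y^2 has trace t^2 - 2. The recursion presupposes that \<open>V\<close>
            is a commutator; the initial word has trace 2 and was excluded separately.\<close>
          have "tr Q - 2 = (?v - 2) * (?v + 2 - ?t\<^sup>2)"
            using tr_comm_comm[of "eng i (upper s) Y" Y]
            by (simp add: Q_def V_def Suc \<open>k = Suc m\<close> Y det_eng)
          moreover have "mcong p Q (Y * Y)"
            unfolding Q_eq using mcong_mult[OF mcong_adj[OF 2] mcong_refl] by simp
          from mcong_tr[OF this] have "p dvd tr Q - (?t\<^sup>2 - 2)"
            by (simp add: tr_square Y cong_iff_dvd_diff)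
          moreover have "?t\<^sup>2 = ((?v - 2) * (?v + 2 - ?t\<^sup>2)) - (?t\<^sup>2 - 4) - ?v * (?v - ?t\<^sup>2)"
            by (simp add: algebra_simps power2_eq_square)
          ultimately have "?t\<^sup>2 = tr Q - (?t\<^sup>2 - 2) - ?v * (?v - ?t\<^sup>2)"
            by simp
          with trV \<open>p dvd tr Q - (?t\<^sup>2 - 2)\<close> have "p dvd ?t\<^sup>2"
            by (metis dvd_diff dvd_mult2)
          then show ?thesis
            using Y by simp
        qed
      next
        case 3
        have "p dvd tr (eng (Suc k) (upper s) Y) - 2"
          using mcong_tr[OF QY(2)] by (simp add: Q_def cong_iff_dvd_diff)
        moreover have "\<not> p dvd tr (comm (upper s) Y) - 2"
          using c by (simp add: tr_comm_upper Y)
        ultimately show ?thesis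
          using tr_eng_parabolic[of "upper s" Y k] 3 Y by simp
      qed
    qed
  qed
qed

text \<open>The trace minus 2 stays a nonzero square, whereas it would have to be 0 or $-4$.\<close>

lemma eng_upper_left_nontrivial:
  assumes Y: "det Y = 1" and c: "\<not> p dvd e21 Y" 
  shows "\<not> psim p (eng k Y (upper 1)) 1"
proof (cases k)
  case 0
  then show ?thesis
    using c by (cases Y) (auto simp: psim_def one_mat2_def mcong_dvd)
next
  case (Suc m)
  have sq: "\<exists>r. \<not> p dvd r \<and> [tr (eng (Suc m) Y (upper 1)) - 2 = r\<^sup>2] (mod p)" for m
  proof (induction m)
    case 0
    then show ?case
      using c Y by (auto simp: tr_comm_upper intro!: exI[of _ "e21 Y"])
  next
    case (Suc m)
    let ?t = "tr (eng (Suc m) Y (upper 1))"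
    have "tr (eng (Suc (Suc m)) Y (upper 1)) - 2 = (?t - 2) * (?t + 2 - (tr (upper 1))\<^sup>2)"
      using tr_comm_comm[OF det_eng[OF Y det_upper] det_upper] by simp
    then have "tr (eng (Suc (Suc m)) Y (upper 1)) - 2 = (?t - 2)\<^sup>2"
      by (simp add: upper_def power2_eq_square algebra_simps)
    moreover obtain r where "\<not> p dvd r" "[?t - 2 = r\<^sup>2] (mod p)"
      using Suc by blast
    then have "\<not> p dvd ?t - 2"
      by (simp add: cong_dvd_iff)
    ultimately show ?case
      by (metis cong_refl)
  qed
  then obtain r where r: "\<not> p dvd r" "[tr (eng k Y (upper 1)) - 2 = r\<^sup>2] (mod p)"
    using Suc by blast
  show ?thesis
  proof
    assume "psim p (eng k Y (upper 1)) 1"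
    then have "[tr (eng k Y (upper 1)) - 2 = 2 - 2] (mod p) \<or>
        [tr (eng k Y (upper 1)) - 2 = - 2 - 2] (mod p)"
      using psim_tr cong_diff cong_refl by blast
    then have "[r\<^sup>2 = 0] (mod p) \<or> [r\<^sup>2 = - 4] (mod p)"
      using cong_trans[OF cong_sym[OF r(2)]] by auto
    then have "p dvd r\<^sup>2 \<or> p dvd r\<^sup>2 + 2\<^sup>2"
      by (auto simp: cong_iff_dvd_diff)
    then show False
      using two_squares[of r 2] r(1) by auto
  qed
qed

end

section \<open>Arcs between matrices modulo p\<close>

definition mconj :: "mat2 \<Rightarrow> mat2 \<Rightarrow> mat2" where
  "mconj g A = adj g * A * g"

lemma conj_mult: "det g = 1 \<Longrightarrow> mconj g (A * B) = mconj g A * mconj g B"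
  by (simp add: mconj_def mult.assoc adj_cancel)

lemma conj_adj: "mconj g (adj A) = adj (mconj g A)"
  by (simp add: mconj_def adj_mult mult.assoc)

lemma conj_1: "det g = 1 \<Longrightarrow> mconj g 1 = 1"
  by (simp add: mconj_def adj_cancel)

lemma conj_adj_cancel:
  "det g = 1 \<Longrightarrow> mconj (adj g) (mconj g A) = A" "det g = 1 \<Longrightarrow> mconj g (mconj (adj g) A) = A"
  by (simp_all add: mconj_def mult.assoc adj_cancel)

lemma det_conj: "det g = 1 \<Longrightarrow> det (mconj g A) = det A"
  by (simp add: mconj_def det_mult)

lemma tr_conj: "det g = 1 \<Longrightarrow> tr (mconj g A) = tr A"
  by (metis mconj_def tr_commute adj_cancel(4) mult.assoc)

lemma eng_conj: "det g = 1 \<Longrightarrow> eng k (mconj g A) (mconj g B) = mconj g (eng k A B)"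
  by (induction k) (simp_all add: comm_def conj_mult conj_adj)

lemma psim_conj: "psim p A B \<Longrightarrow> psim p (mconj g A) (mconj g B)"
  by (simp add: mconj_def psim_mult)

lemma psim_conj_1_iff:
  assumes "det g = 1"
  shows "psim p (mconj g A) 1 \<longleftrightarrow> psim p A 1"
  using psim_conj[of p A 1 g] psim_conj[of p "mconj g A" 1 "adj g"] assms
  by (auto simp: conj_1 conj_adj_cancel)

lemma psim_comm_1: "det B = 1 \<Longrightarrow> psim p A 1 \<Longrightarrow> psim p (comm A B) 1"
  using psim_comm[of p A 1 B B] by (simp add: comm_def adj_cancel)

lemma psim_eng_mono: "det B = 1 \<Longrightarrow> psim p (eng j A B) 1 \<Longrightarrow> j \<le> k \<Longrightarrow> psim p (eng k A B) 1"
  by (induction k) (auto simp: le_Suc_eq psim_comm_1)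

lemma psim_comm_commuting:
  assumes "det A = 1" "det B = 1" "mcong p (A * B) (B * A)"
  shows "psim p (comm A B) 1"
proof -
  have "mcong p (adj A * adj B * (A * B)) (adj A * adj B * (B * A))"
    by (intro mcong_mult mcong_refl assms)
  then show ?thesis
    using assms by (simp add: comm_def mult.assoc adj_cancel mcong_imp_psim)
qed

lemma adj_traceless: "p dvd tr A \<Longrightarrow> mcong p (adj A) (- A)"
  by (cases A) (simp add: mcong_def cong_iff_dvd_diff add.commute)

context prime_3_mod_4
begin

lemma abs_p_neq_1 [simp]: "\<bar>p\<bar> \<noteq> 1"
  using gt_5 by simp

lemma inverse_mod: "\<not> p dvd a \<Longrightarrow> \<exists>b. p dvd a * b - 1"
  using cong_solve_coprime_int[of a p] prime_imp_coprime[OF prime, of a]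
  by (auto simp: coprime_commute cong_iff_dvd_diff)

text \<open>Comparing diagonals in \<open>upper x * lower c * upper z\<close> forces x = (a - 1)/c
  and z = (d - 1)/c; the determinant settles the remaining entry.\<close>

lemma generation_nonzero_corner:
  assumes "p dvd a * d - b * c - 1" "\<not> p dvd c"
  shows "\<exists>x y z. mcong p (Mat a b c d) (upper x * lower y * upper z)"
proof -
  obtain c' where c': "p dvd c * c' - 1"
    using inverse_mod assms(2) by blast
  let ?e = "c * c' - 1" and ?f = "a * d - b * c - 1"
  let ?x = "(a - 1) * c'" and ?z = "(d - 1) * c'"
  have "1 + ?x * c - a = (a - 1) * ?e" "c * ?z + 1 - d = (d - 1) * ?e"
    "(1 + ?x * c) * ?z + ?x - b = b * ?e + c' * ?f + (d - 1) * (a - 1) * c' * ?e"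
    by (simp_all add: algebra_simps)
  then have "p dvd 1 + ?x * c - a" "p dvd c * ?z + 1 - d" "p dvd (1 + ?x * c) * ?z + ?x - b"
    using assms(1) c' by (metis dvd_add dvd_mult)+
  then have "mcong p (upper ?x * lower c * upper ?z) (Mat a b c d)"
    by (simp add: upper_def lower_def mcong_dvd)
  then show ?thesis
    using mcong_sym by blast
qed

lemma generation:
  assumes "p dvd a * d - b * c - 1"
  shows "\<exists>x y z w. mcong p (Mat a b c d) (upper x * lower y * upper z * lower w)"
proof (cases "p dvd c")
  case False
  moreover have "lower 0 = 1"
    by (simp add: lower_def one_mat2_def)
  ultimately show ?thesis
    using generation_nonzero_corner[OF assms] by (metis mult_1_right)
next
  case True
  have "\<not> p dvd d"
  proof
    assume "p dvd d"
    then have "p dvd a * d - b * c"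
      using True by (simp add: dvd_diff)
    from dvd_diff[OF this assms] show False
      using not_dvd_small[of 1] by simp
  qed
  then have "\<not> p dvd c + d"
    using True by (simp add: dvd_add_right_iff)
  moreover have "p dvd (a + b) * d - b * (c + d) - 1"
    using assms by (simp add: algebra_simps)
  ultimately obtain x y z where
    "mcong p (Mat (a + b) b (c + d) d) (upper x * lower y * upper z)"
    using generation_nonzero_corner by blast
  from mcong_mult[OF this mcong_refl[of p "lower (- 1)"]]
  show ?thesis
    by (auto simp: lower_def)
qed

text \<open>Surjectivity of SL(2, Z) onto SL(2, p), because the elementary generators lift.\<close>

lemma lift_SL2:
  assumes "p dvd a * d - b * c - 1"
  obtains A where "det A = 1" "mcong p A (Mat a b c d)"
proof -
  obtain x y z w where "mcong p (Mat a b c d) (upper x * lower y * upper z * lower w)"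
    using generation[OF assms] by blast
  then show ?thesis
    by (intro that[of "upper x * lower y * upper z * lower w"]) (simp_all add: det_mult mcong_sym)
qed

text \<open>Modulo $p$, the involution $Y$ inverts $[V, Y]$.\<close>

lemma comm_comm_involution:
  assumes "det V = 1" "det Y = 1" "p dvd tr Y"
  shows "mcong p (comm (comm V Y) Y) (adj (comm V Y * comm V Y))"
proof -
  define W where "W = adj V * Y * V"
  have "tr W = tr Y"
    using tr_conj[OF assms(1)] by (simp add: W_def mconj_def)
  then have W: "mcong p (- adj W) W"
    using adj_traceless[of p W] assms(3) mcong_minus by fastforce
  have Z: "comm V Y = adj W * Y"
    by (simp add: comm_def W_def adj_mult mult.assoc)
  have "mcong p (Y * Y) (- 1)"
    using assms by (simp add: square_traceless cong_0_iff)
  then have "mcong p (adj W * (Y * Y)) (adj W * (- 1))"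
    by (intro mcong_mult mcong_refl)
  then have "mcong p (adj W * (Y * Y)) W"
    using W mcong_trans by simp
  then have "mcong p (adj (comm V Y) * (adj Y * (adj W * (Y * Y)))) (adj (comm V Y) * (adj Y * W))"
    by (intro mcong_mult mcong_refl)
  then show ?thesis
    by (simp add: comm_def [of "comm V Y"]) (simp add: Z adj_mult mult.assoc)
qed

text \<open>The word with index k + 1 has trace 0, hence square -1, and the next commutator is the
  inverse of that square.\<close>

lemma eng_involution_trivial:
  assumes "det Y = 1" "p dvd tr Y" "p dvd trace_pow2 k ((e21 Y * s)\<^sup>2 + 2)"
  shows "psim p (eng (k + 2) (upper s) Y) 1"
proof -
  define Z where "Z = eng (Suc k) (upper s) Y"
  have Z: "det Z = 1"
    by (simp add: Z_def det_eng assms(1) del: eng.simps)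
  have "[tr Z = trace_pow2 k (tr (comm (upper s) Y))] (mod p)"
    unfolding Z_def by (rule tr_eng_involution) (simp_all add: assms)
  then have "p dvd tr Z"
    using assms by (simp add: tr_comm_upper cong_dvd_iff)
  then have "mcong p (Z * Z) (- 1)"
    using Z by (simp add: square_traceless cong_0_iff)
  then have "mcong p (adj (Z * Z)) (- 1)"
    using mcong_adj by fastforce
  moreover have "mcong p (comm Z Y) (adj (Z * Z))"
    unfolding Z_def eng.simps by (rule comm_comm_involution) (simp_all add: assms det_eng)
  ultimately show ?thesis
    using mcong_trans by (auto simp: psim_def Z_def)
qed

text \<open>The trace conditions make \<open>J\<close> and \<open>J * A\<close> involutions, so
  \<open>J\<close> inverts \<open>A\<close> up to sign. Then [J, A] is A^2 up to sign, which
  commutes with \<open>A\<close>.\<close>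

lemma eng_involution_inverted:
  assumes "det J = 1" "det A = 1" "p dvd tr J" "p dvd tr (J * A)"
  shows "psim p (eng 2 J A) 1"
proof -
  have "mcong p (adj A * (- J)) (adj A * adj J)"
    by (intro mcong_mult mcong_refl mcong_sym[OF adj_traceless] assms)
  also have "mcong p (adj A * adj J) (- (J * A))"
    using adj_traceless[OF assms(4)] by (simp add: adj_mult)
  finally have "mcong p (adj A * J) (J * A)"
    using mcong_minus by fastforce
  then have "mcong p (adj J * (adj A * J) * A) (adj J * (J * A) * A)"
    by (rule mcong_mult[OF mcong_mult[OF mcong_refl] mcong_refl])
  then have "psim p (comm J A) (A * A)"
    by (simp add: comm_def mult.assoc adj_cancel assms mcong_imp_psim)
  from psim_comm[OF this psim_refl[of p A]] have "psim p (comm (comm J A) A) (comm (A * A) A)" .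
  moreover have "comm (A * A) A = 1"
    by (simp add: comm_def adj_mult mult.assoc adj_cancel assms)
  ultimately show ?thesis
    by (simp add: eval_nat_numeral)
qed

text \<open>Commutators in the Borel subgroup are unipotent, and the unipotent upper triangular
  matrices commute.\<close>

lemma eng_triangular_upper:
  assumes "det A = 1" "p dvd e21 A"
  shows "psim p (eng 2 A (upper 1)) 1"
proof -
  obtain a b c d where A: "A = Mat a b c d" by (cases A)
  have ad: "p dvd a * d - 1"
    using assms dvd_mult[of p c b] by (simp add: A algebra_simps)
  have "psim p A (Mat a b 0 d)"
    using assms(2) by (simp add: A mcong_dvd mcong_imp_psim)
  from psim_comm[OF this psim_refl]
  have "psim p (comm A (upper 1)) (comm (Mat a b 0 d) (upper 1))" .
  also obtain x where "comm (Mat a b 0 d) (upper 1) = Mat (a * d) x 0 (a * d)"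
    by (simp add: comm_def upper_def mult.commute)
  also have "psim p (Mat (a * d) x 0 (a * d)) (upper x)"
    using ad by (simp add: upper_def mcong_dvd mcong_imp_psim)
  finally have "psim p (comm (comm A (upper 1)) (upper 1)) (comm (upper x) (upper 1))"
    by (intro psim_comm psim_refl)
  also have "comm (upper x) (upper 1) = 1"
    by (simp add: comm_def upper_def one_mat2_def)
  finally show ?thesis
    by (simp add: eval_nat_numeral)
qed

text \<open>The Legendre symbols of \<open>a\<close> and \<open>- a\<close> are opposite. Applied to
  (tr A)^2 - 4, this separates split from nonsplit elements.\<close>

lemma square_or_minus_square: "\<exists>x. [x\<^sup>2 = a] (mod p) \<or> [x\<^sup>2 = - a] (mod p)"
proof -
  define q where "q = nat p"
  have q: "p = int q" "prime q" "q > 2"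
    using prime gt_5 by (auto simp: q_def)
  have "odd ((q - 1) div 2)"
    using mod_4 q(1) by presburger
  then have "(- a) ^ ((q - 1) div 2) = - (a ^ ((q - 1) div 2))"
    by simp
  then have eq: "[Legendre (- a) p = - Legendre a p] (mod p)"
    using euler_criterion[OF q(2,3), of a] euler_criterion[OF q(2,3), of "- a"] unfolding q(1)
    by (metis cong_minus_minus_iff cong_sym cong_trans)
  show ?thesis
  proof (rule ccontr)
    assume *: "\<not> ?thesis"
    then have "Legendre a p = - 1" "Legendre (- a) p = - 1"
      using * by (auto simp: Legendre_def QuadRes_def cong_sym dest: spec[of _ 0])
    then have "p dvd 2"
      using eq by (simp add: cong_iff_dvd_diff)
    then show False
      using not_dvd_small[of 2] by simp
  qed
qed

section \<open>The Engel digraph on integral representatives\<close>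

definition engel_verts :: "mat2 set" where
  "engel_verts = {A. det A = 1 \<and> \<not> psim p A 1}"

definition engel_arcs :: "nat \<Rightarrow> mat2 rel" where
  "engel_arcs k = {(A, B). A \<in> engel_verts \<and> B \<in> engel_verts \<and> psim p (eng k A B) 1}"

definition link :: "nat \<Rightarrow> mat2 \<Rightarrow> mat2 \<Rightarrow> bool" where
  "link k A B \<longleftrightarrow> (A, B) \<in> (engel_arcs k)\<^sup>* \<and> (B, A) \<in> (engel_arcs k)\<^sup>*"

lemma link_sym: "link k A B \<Longrightarrow> link k B A"
  and link_trans: "link k A B \<Longrightarrow> link k B C \<Longrightarrow> link k A C"
  by (auto simp: link_def)

lemma verts_conj: "det g = 1 \<Longrightarrow> mconj g A \<in> engel_verts \<longleftrightarrow> A \<in> engel_verts"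
  by (simp add: engel_verts_def psim_conj_1_iff det_conj)

lemma reach_conj:
  "(A, B) \<in> (engel_arcs k)\<^sup>* \<Longrightarrow> det g = 1 \<Longrightarrow> (mconj g A, mconj g B) \<in> (engel_arcs k)\<^sup>*"
proof (induction rule: rtrancl_induct)
  case (step B C)
  then have "(mconj g B, mconj g C) \<in> engel_arcs k"
    by (simp add: engel_arcs_def verts_conj eng_conj psim_conj_1_iff)
  with step show ?case by (meson rtrancl.rtrancl_into_rtrancl)
qed simp

lemma link_conj: "link k A B \<Longrightarrow> det g = 1 \<Longrightarrow> link k (mconj g A) (mconj g B)"
  by (simp add: link_def reach_conj)

lemma arcI:
  "A \<in> engel_verts \<Longrightarrow> B \<in> engel_verts \<Longrightarrow> psim p (eng j A B) 1 \<Longrightarrow> j \<le> k \<Longrightarrow>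
    (A, B) \<in> (engel_arcs k)\<^sup>*"
  using psim_eng_mono[of B p j A k] by (auto simp: engel_arcs_def engel_verts_def)

lemma arc2I:
  "A \<in> engel_verts \<Longrightarrow> B \<in> engel_verts \<Longrightarrow> psim p (eng 2 A B) 1 \<Longrightarrow>
    (A, B) \<in> (engel_arcs (k + 2))\<^sup>*"
  by (intro arcI[of A B 2 "k + 2"] le_add2)

lemma link_commuting:
  assumes "A \<in> engel_verts" "B \<in> engel_verts" "mcong p (A * B) (B * A)" "k \<ge> 1"
  shows "link k A B"
proof -
  have "psim p (eng 1 A B) 1" "psim p (eng 1 B A) 1"
    using assms by (simp_all add: engel_verts_def psim_comm_commuting mcong_sym)
  then show ?thesis
    using assms arcI[of A B 1 k] arcI[of B A 1 k] by (simp add: link_def)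
qed

lemma upper_in_verts: "\<not> p dvd s \<Longrightarrow> upper s \<in> engel_verts"
  by (auto simp: engel_verts_def psim_def upper_def one_mat2_def mcong_dvd)

lemma involution_in_verts: "det J = 1 \<Longrightarrow> p dvd tr J \<Longrightarrow> J \<in> engel_verts"
  using psim_tr[of p J] not_dvd_small[of 2] cong_dvd_iff[of "tr J" _ p] by (fastforce simp: engel_verts_def)

text \<open>A triangular involution would have a diagonal entry with square -1.\<close>

lemma involution_corner:
  assumes "det J = 1" "p dvd tr J"
  shows "\<not> p dvd e21 J"
proof
  assume c: "p dvd e21 J"
  obtain a b c d where J: "J = Mat a b c d" by (cases J)
  have "a\<^sup>2 + 1\<^sup>2 = a * (a + d) - b * c"
    using assms(1) by (simp add: J algebra_simps power2_eq_square)
  then have "p dvd a\<^sup>2 + 1\<^sup>2"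
    using c assms(2) by (simp add: J dvd_diff)
  then show False
    using two_squares[of a 1] not_dvd_small[of 1] by simp
qed

text \<open>
  The way out of the unipotent group: $[u_s, J]$ has trace $(c s)^2 + 2$, which is $11$ if
  $c s = 3$, and so it has order $2^{k+1}$ in $\mathrm{PSL}_2(p)$. The way back leads through a
  diagonalizable upper triangular matrix inverted by $J$.
\<close>

lemma link_involution_upper:
  assumes J: "det J = 1" "p dvd tr J" and k: "p dvd trace_pow2 k 11"
  shows "link (k + 2) J (upper 1)"
proof -
  have Jv: "J \<in> engel_verts"
    using involution_in_verts J by blast
  have u1: "upper 1 \<in> engel_verts"
    using upper_in_verts not_dvd_small[of 1] by simp
  obtain a b c d where J_eq: "J = Mat a b c d" by (cases J)
  have c: "\<not> p dvd c"
    using involution_corner[OF J] by (simp add: J_eq)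
  obtain c' where c': "p dvd c * c' - 1"
    using inverse_mod[OF c] by blast
  define s where "s = 3 * c'"
  have cs: "[c * s = 3] (mod p)"
    using dvd_mult[OF c', of 3] by (simp add: s_def cong_iff_dvd_diff algebra_simps)
  have s: "\<not> p dvd s"
  proof
    assume "p dvd s"
    then have "p dvd 3"
      using cong_dvd_iff[OF cs] by simp
    then show False
      using not_dvd_small[of 3] by simp
  qed
  have "p dvd trace_pow2 k ((c * s)\<^sup>2 + 2)"
    using trace_pow2_cong[OF cong_add[OF cong_pow[OF cs, of 2] cong_refl[of 2]], of k] k
    by (simp add: cong_dvd_iff)
  then have "(upper s, J) \<in> (engel_arcs (k + 2))\<^sup>*"
    using eng_involution_trivial[OF J, of k s] upper_in_verts[OF s] Jv
    by (intro arcI[of _ _ "k + 2"]) (simp_all add: J_eq)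
  moreover have "link (k + 2) (upper 1) (upper s)"
    using u1 s by (intro link_commuting upper_in_verts) (auto simp: upper_def add.commute)
  ultimately have 1: "(upper 1, J) \<in> (engel_arcs (k + 2))\<^sup>*"
    by (auto simp: link_def)
  \<comment> \<open>\<open>A\<close> gets the eigenvalues 2 and 1/2, and \<open>y\<close> solves tr
    (J A) = 2 a + c y + d h = 0, using d = -a.\<close>
  obtain h where h: "p dvd 2 * h - 1"
    using inverse_mod not_dvd_small[of 2] by auto
  define y where "y = (h - 2) * a * c'"
  have "p dvd 2 * h - y * 0 - 1"
    using h by simp
  then obtain A where A: "det A = 1" "mcong p A (Mat 2 y 0 h)"
    using lift_SL2 by blast
  have "tr (J * Mat 2 y 0 h) = a * 2 + c * y + d * h"
    by (simp add: J_eq algebra_simps)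
  also have "\<dots> = (a + d) * h + a * (h - 2) * (c * c' - 1)"
    by (simp add: y_def algebra_simps)
  finally have "p dvd tr (J * Mat 2 y 0 h)"
    using c' J by (simp add: J_eq)
  then have trJA: "p dvd tr (J * A)"
    using mcong_tr[OF mcong_mult[OF mcong_refl A(2)]] by (metis cong_dvd_iff)
  have eA: "p dvd e21 A"
    using A(2) by (cases A) (simp add: mcong_dvd)
  have Av: "A \<in> engel_verts"
  proof -
    have "\<not> psim p A 1"
    proof
      assume "psim p A 1"
      then have "psim p (Mat 2 y 0 h) 1"
        using A(2) psim_trans mcong_imp_psim mcong_sym by blast
      then have "p dvd 2 - 1 \<or> p dvd 2 - (- 1)"
        unfolding psim_def one_mat2_def Mat_arith mcong_dvd by blast
      then show False
        using not_dvd_small[of 1] not_dvd_small[of 3] by auto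
    qed
    then show ?thesis by (simp add: engel_verts_def A)
  qed
  have "(J, A) \<in> (engel_arcs (k + 2))\<^sup>*"
    by (intro arc2I Jv Av eng_involution_inverted J A trJA)
  moreover have "(A, upper 1) \<in> (engel_arcs (k + 2))\<^sup>*"
    by (intro arc2I u1 Av eng_triangular_upper A eA)
  ultimately show ?thesis
    using 1 by (auto simp: link_def)
qed

text \<open>For the way back: with equal diagonal entries \<open>B\<close> commutes with
  \<open>upper 1\<close>; with distinct ones it is inverted by an involution, which is already
  linked to \<open>upper 1\<close>.\<close>

lemma link_triangular_upper:
  assumes B: "B \<in> engel_verts" "p dvd e21 B" and k: "p dvd trace_pow2 k 11"
  shows "link (k + 2) B (upper 1)"
proof -
  have u1: "upper 1 \<in> engel_verts"
    using upper_in_verts not_dvd_small[of 1] by simp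
  obtain a b c d where B_eq: "B = Mat a b c d" by (cases B)
  have c: "p dvd c" and det: "a * d - b * c = 1"
    using B by (auto simp: B_eq engel_verts_def)
  have eq: "(a - d) * a - (a * a - 1) = - (a * d - b * c - 1) - b * c"
    by (simp add: algebra_simps)
  have 1: "(B, upper 1) \<in> (engel_arcs (k + 2))\<^sup>*"
    using B by (intro arc2I u1 eng_triangular_upper) (auto simp: engel_verts_def)
  have 2: "(upper 1, B) \<in> (engel_arcs (k + 2))\<^sup>*"
  proof (cases "p dvd a - d")
    case True
    have "mcong p (upper 1 * B) (B * upper 1)"
      using True c by (simp add: B_eq upper_def mcong_dvd dvd_diff_commute)
    then show ?thesis
      using link_commuting[of "upper 1" B] u1 B by (simp add: link_def)
  next
    case False
    obtain f where f: "p dvd (a - d) * f - 1"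
      using inverse_mod[OF False] by blast
    \<comment> \<open>A traceless matrix of determinant 1 with lower left entry 1 has one free
      parameter; x = -b/(a - d) makes tr (J B) vanish modulo \<open>p\<close>.\<close>
    define x where "x = - b * f"
    have "p dvd x * (- x) - (- (1 + x\<^sup>2)) * 1 - 1"
      by (simp add: power2_eq_square)
    then obtain J where J: "det J = 1" "mcong p J (Mat x (- (1 + x\<^sup>2)) 1 (- x))"
      using lift_SL2 by blast
    have trJ: "p dvd tr J"
      using mcong_tr[OF J(2)] by (simp add: cong_0_iff)
    have "tr (Mat x (- (1 + x\<^sup>2)) 1 (- x) * B) = - (1 + x\<^sup>2) * c - b * ((a - d) * f - 1)"
      by (simp add: B_eq x_def algebra_simps)
    then have "p dvd tr (Mat x (- (1 + x\<^sup>2)) 1 (- x) * B)"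
      using c f by (metis dvd_diff dvd_mult)
    then have "p dvd tr (J * B)"
      using mcong_tr[OF mcong_mult[OF J(2) mcong_refl]] by (metis cong_dvd_iff)
    then have "(J, B) \<in> (engel_arcs (k + 2))\<^sup>*"
      using B \<open>p dvd tr (J * B)\<close> involution_in_verts[OF J(1) trJ]
      by (intro arc2I eng_involution_inverted[OF J(1) _ trJ]) (auto simp: engel_verts_def)
    then show ?thesis
      using link_involution_upper[OF J(1) trJ k] by (auto simp: link_def)
  qed
  show ?thesis
    using 1 2 by (simp add: link_def)
qed

text \<open>The matrix 2 A - tr A is traceless, commutes with \<open>A\<close> and has determinant 4
  - (tr A)^2; dividing it by \<open>x\<close> gives the involution of the torus.\<close>

lemma commuting_involution:
  assumes "det A = 1" "\<not> p dvd x" "[x\<^sup>2 = 4 - (tr A)\<^sup>2] (mod p)"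
  obtains J where "det J = 1" "p dvd tr J" "mcong p (A * J) (J * A)"
proof -
  obtain a b c d where A: "A = Mat a b c d" by (cases A)
  obtain y where y: "p dvd x * y - 1"
    using inverse_mod[OF assms(2)] by blast
  let ?M = "Mat (y * (a - d)) (y * (2 * b)) (y * (2 * c)) (y * (d - a))"
  have det: "a * d - b * c = 1"
    using assms(1) by (simp add: A)
  have "y * (a - d) * (y * (d - a)) - y * (2 * b) * (y * (2 * c)) - 1
      = y\<^sup>2 * (4 * (a * d - b * c) - (a + d)\<^sup>2) - 1"
    by (simp add: algebra_simps power2_eq_square)
  also have "\<dots> = - (y\<^sup>2 * (x\<^sup>2 - (4 - (tr A)\<^sup>2))) + (x * y - 1) * (x * y + 1)"
    unfolding det by (simp add: A algebra_simps power2_eq_square)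
  also have "p dvd \<dots>"
    using assms(3) y unfolding cong_iff_dvd_diff by (intro dvd_add) auto
  finally obtain J where J: "det J = 1" "mcong p J ?M"
    using lift_SL2 by blast
  have "mcong p (A * J) (A * ?M)" "mcong p (?M * A) (J * A)"
    by (intro mcong_mult mcong_refl J mcong_sym[OF J(2)])+
  moreover have "A * ?M = ?M * A"
    by (simp add: A algebra_simps)
  ultimately have "mcong p (A * J) (J * A)"
    using mcong_trans by metis
  moreover have "p dvd tr J"
    using mcong_tr[OF J(2)] by (simp add: cong_0_iff algebra_simps)
  ultimately show ?thesis
    using J(1) that by blast
qed

text \<open>If c is not 0, a square root \<open>x\<close> of the discriminant yields the fixed point
  m = (a - d + x)/(2 c) of the Moebius action of \<open>A\<close>. The conjugating matrix takes
  infinity to m, so the conjugate fixes infinity.\<close>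

lemma conj_triangular:
  assumes "[x\<^sup>2 = (tr A)\<^sup>2 - 4] (mod p)" "det A = 1"
  obtains g where "det g = 1" "p dvd e21 (mconj g A)"
proof -
  obtain a b c d where A: "A = Mat a b c d" by (cases A)
  show ?thesis
  proof (cases "p dvd c")
    case True
    then show ?thesis
      using that[of 1] by (simp add: A mconj_def)
  next
    case False
    then obtain f where f: "p dvd 2 * c * f - 1"
      using inverse_mod[of "2 * c"] not_dvd_small[of 2] by auto
    define m where "m = (a - d + x) * f"
    define z where "z = c * m\<^sup>2 + (d - a) * m - b"
    have m: "2 * c * m + d - a = x + (a - d + x) * (2 * c * f - 1)"
      by (simp add: m_def algebra_simps)
    have det: "(a + d)\<^sup>2 - 4 = (a - d)\<^sup>2 + 4 * b * c"
    proof -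
      have "(a + d)\<^sup>2 - 4 = (a + d)\<^sup>2 - 4 * (a * d - b * c)"
        using assms(2) by (simp add: A)
      then show ?thesis
        by (simp add: algebra_simps power2_eq_square)
    qed
    have "4 * c * z = (2 * c * m + d - a)\<^sup>2 - ((a - d)\<^sup>2 + 4 * b * c)"
      by (simp add: z_def algebra_simps power2_eq_square)
    also have "\<dots> = (x\<^sup>2 - ((tr A)\<^sup>2 - 4))
        + (2 * c * f - 1) * ((a - d + x) * (2 * x + (a - d + x) * (2 * c * f - 1)))"
      unfolding m by (simp add: A det) (simp add: algebra_simps power2_eq_square)
    finally have "4 * c * z = \<dots>" .
    then have "p dvd 4 * c * z"
      using assms(1) f by (metis cong_iff_dvd_diff dvd_add dvd_mult2)
    then have "p dvd z"
      using False not_dvd_small[of 4] by simp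
    moreover have "e21 (mconj (Mat m (- 1) 1 0) A) = z"
      by (simp add: A mconj_def z_def algebra_simps power2_eq_square)
    ultimately show ?thesis
      using that[of "Mat m (- 1) 1 0"] by simp
  qed
qed

lemma all_linked:
  assumes A: "A \<in> engel_verts" and k: "p dvd trace_pow2 k 11"
  shows "link (k + 2) A (upper 1)"
proof -
  have det: "det A = 1"
    using A by (simp add: engel_verts_def)
  obtain x where "[x\<^sup>2 = (tr A)\<^sup>2 - 4] (mod p) \<or> [x\<^sup>2 = - ((tr A)\<^sup>2 - 4)] (mod p)"
    using square_or_minus_square by blast
  \<comment> \<open>For x = 0 both signs agree; elements of trace 2 or -2 are counted as
    split.\<close>
  then consider (split) x where "[x\<^sup>2 = (tr A)\<^sup>2 - 4] (mod p)"
    | (nonsplit) x where "\<not> p dvd x" "[x\<^sup>2 = 4 - (tr A)\<^sup>2] (mod p)"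
  proof -
    assume *: "\<And>x. [x\<^sup>2 = (tr A)\<^sup>2 - 4] (mod p) \<Longrightarrow> thesis"
      "\<And>x. \<not> p dvd x \<Longrightarrow> [x\<^sup>2 = 4 - (tr A)\<^sup>2] (mod p) \<Longrightarrow> thesis"
    have "[x\<^sup>2 = (tr A)\<^sup>2 - 4] (mod p)" if "p dvd x" "[x\<^sup>2 = 4 - (tr A)\<^sup>2] (mod p)"
    proof -
      have "p dvd 2 * x\<^sup>2 - (x\<^sup>2 - (4 - (tr A)\<^sup>2))"
        using that dvd_diff[of p "2 * x\<^sup>2" "x\<^sup>2 - (4 - (tr A)\<^sup>2)"] by (simp add: cong_iff_dvd_diff)
      then show ?thesis
        by (simp add: cong_iff_dvd_diff algebra_simps)
    qed
    with \<open>_ \<or> _\<close> * show thesis by force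
  qed
  then show ?thesis
  proof cases
    case split
    obtain g where g: "det g = 1" "p dvd e21 (mconj g A)"
      using conj_triangular[OF split det] by blast
    have "link (k + 2) (mconj g A) (upper 1)"
      using link_triangular_upper[OF _ g(2) k] A g by (simp add: verts_conj)
    then have 1: "link (k + 2) A (mconj (adj g) (upper 1))"
      using link_conj[of "k + 2" "mconj g A" "upper 1" "adj g"] g by (simp add: conj_adj_cancel)
    \<comment> \<open>Conjugation reaches only a conjugate of \<open>upper 1\<close>. The two
      unipotent groups are joined through \<open>w\<close>: every involution is linked to
      \<open>upper 1\<close>, in particular both \<open>w\<close> and its conjugate.\<close>
    define w where "w = Mat 0 (- 1) 1 0"
    have w: "det w = 1" "tr w = 0"
      by (simp_all add: w_def)
    have "link (k + 2) (mconj g w) (upper 1)"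
      using link_involution_upper k g w by (simp add: det_conj tr_conj)
    then have "link (k + 2) w (mconj (adj g) (upper 1))"
      using link_conj[of "k + 2" "mconj g w" "upper 1" "adj g"] g by (simp add: conj_adj_cancel)
    moreover have "link (k + 2) w (upper 1)"
      using link_involution_upper k w by simp
    ultimately show ?thesis
      using 1 link_sym link_trans by blast
  next
    case nonsplit
    obtain J where J: "det J = 1" "p dvd tr J" "mcong p (A * J) (J * A)"
      using commuting_involution[OF det nonsplit] by blast
    have "link (k + 2) A J"
      using link_commuting[OF A involution_in_verts[OF J(1,2)] J(3)] by simp
    then show ?thesis
      using link_involution_upper[OF J(1,2) k] link_trans by blast
  qed
qed

text \<open>The conjugates by 1, by the Weyl element and by \<open>lower 1\<close> have corners c,
  -b and c - b - (a - d). If all vanish, \<open>A\<close> is scalar and hence 1 or -1.\<close>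

lemma conj_nonzero_corner:
  assumes "A \<in> engel_verts"
  shows "\<exists>g. det g = 1 \<and> \<not> p dvd e21 (mconj g A)"
proof (rule ccontr)
  assume *: "\<not> ?thesis"
  obtain a b c d where A: "A = Mat a b c d" by (cases A)
  have corner: "p dvd e21 (mconj g A)" if "det g = 1" for g
    using * that by blast
  have c: "p dvd c"
    using corner[of 1] by (simp add: A mconj_def)
  have b: "p dvd b"
    using corner[of "Mat 0 (- 1) 1 0"] by (simp add: A mconj_def)
  have ad: "p dvd a - d"
  proof -
    have "e21 (mconj (lower 1) A) = c - b - (a - d)"
      by (simp add: A mconj_def lower_def)
    then have "p dvd c - b - (a - d)"
      using corner[of "lower 1"] by simp
    from dvd_diff[OF dvd_diff[OF c b] this] show ?thesis by simp
  qed
  have "(a - 1) * (a + 1) = (a * d - b * c - 1) + b * c + a * (a - d)"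
    by (simp add: algebra_simps)
  also have "a * d - b * c - 1 = 0"
    using assms by (simp add: A engel_verts_def)
  finally have "p dvd (a - 1) * (a + 1)"
    using b ad by simp
  then consider "p dvd a - 1" | "p dvd a + 1"
    by auto
  then have "psim p A 1"
  proof cases
    case 1
    with ad have "p dvd (a - 1) - (a - d)"
      using dvd_diff by blast
    with 1 b c show ?thesis
      by (simp add: psim_def A one_mat2_def mcong_dvd)
  next
    case 2
    with ad have "p dvd (a + 1) - (a - d)"
      using dvd_diff by blast
    with 2 b c show ?thesis
      by (simp add: psim_def A one_mat2_def mcong_dvd add.commute)
  qed
  then show False
    using assms by (simp add: engel_verts_def)
qed

text \<open>After conjugation to a nonzero corner \<open>upper 1\<close> is a witness; hence no
  nontrivial element is removed from the graph.\<close>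

lemma not_engel_universal:
  assumes "A \<in> engel_verts"
  obtains X where "det X = 1" "\<not> psim p (eng k A X) 1"
proof -
  obtain g where g: "det g = 1" "\<not> p dvd e21 (mconj g A)"
    using conj_nonzero_corner[OF assms] by blast
  then have "\<not> psim p (eng k (mconj g A) (upper 1)) 1"
    using assms by (intro eng_upper_left_nontrivial) (simp_all add: engel_verts_def det_conj)
  then have "\<not> psim p (mconj g (eng k A (mconj (adj g) (upper 1)))) 1"
    using g(1) by (simp add: conj_adj_cancel flip: eng_conj)
  then show ?thesis
    using g(1) that[of "mconj (adj g) (upper 1)"] by (simp add: psim_conj_1_iff det_conj)
qed

section \<open>The unipotent group is closed under arcs at the lower level\<close>

text \<open>Only one unipotent subgroup without its identity, up to sign, rather than all elements
  of trace 2 or -2.\<close>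

definition parabolic :: "mat2 set" where
  "parabolic = {A. \<exists>s. \<not> p dvd s \<and> psim p A (upper s)}"

text \<open>Conjugation by \<open>Y\<close> scales the parameter of a unipotent by d^2, so each
  commutator multiplies it by d^2 - 1.\<close>

lemma eng_upper_triangular:
  "mcong p Y (Mat a b 0 d) \<Longrightarrow> p dvd a * d - 1 \<Longrightarrow>
     psim p (eng k (upper s) Y) (upper (s * (d\<^sup>2 - 1) ^ k))"
proof (induction k)
  case (Suc k)
  let ?t = "s * (d\<^sup>2 - 1) ^ k"
  have "psim p (eng (Suc k) (upper s) Y) (comm (upper ?t) (Mat a b 0 d))"
    using Suc by (auto intro: psim_comm mcong_imp_psim)
  also have "psim p (comm (upper ?t) (Mat a b 0 d)) (upper (?t * (d\<^sup>2 - 1)))"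
  proof -
    have "comm (upper ?t) (Mat a b 0 d) = Mat (a * d) (?t * (d\<^sup>2 - a * d)) 0 (a * d)"
      by (simp add: comm_def upper_def algebra_simps power2_eq_square)
    moreover have "?t * (d\<^sup>2 - a * d) - ?t * (d\<^sup>2 - 1) = - ?t * (a * d - 1)"
      by (simp add: algebra_simps)
    ultimately show ?thesis
      using Suc.prems(2) by (intro mcong_imp_psim) (simp only: upper_def mcong_dvd, simp)
  qed
  finally show ?case
    by (simp add: mult_ac)
qed simp

lemma parabolic_closed:
  assumes "(A, B) \<in> engel_arcs (Suc k)" "A \<in> parabolic" and k: "p dvd trace_pow2 k 11"
  shows "B \<in> parabolic"
proof -
  obtain s where s: "\<not> p dvd s" "psim p A (upper s)"
    using assms(2) by (auto simp: parabolic_def)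
  have B: "det B = 1" "\<not> psim p B 1"
    using assms(1) by (auto simp: engel_arcs_def engel_verts_def)
  have eng: "psim p (eng (Suc k) (upper s) B) 1"
    using assms(1) psim_trans[OF psim_eng[OF psim_sym[OF s(2)] psim_refl]]
    unfolding engel_arcs_def by blast
  obtain a b c d where B_eq: "B = Mat a b c d" by (cases B)
  have c: "p dvd c"
  proof (rule ccontr)
    assume "\<not> p dvd c"
    then have cs: "\<not> p dvd e21 B * s"
      using s(1) by (simp add: B_eq)
    show False
    proof (cases "p dvd tr B")
      case True
      have "\<not> p dvd trace_pow2 j ((e21 B * s)\<^sup>2 + 2)" if "Suc j < Suc k" for j
        \<comment> \<open>Since 11 = 3^2 + 2, the zero at \<open>k\<close> belongs to P = 3; for any
          other P a zero can only occur at the same index, while here \<open>j\<close> is below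
          \<open>k\<close>.\<close>
        using trace_pow2_zero_unique[OF prime mod_4, of k 3 j "e21 B * s"] k that by auto
      then show False
        using eng_involution_nontrivial[OF B(1) True cs] eng by blast
    next
      case False
      then show False
        using eng_noninvolution_nontrivial[OF B(1) False cs] eng by blast
    qed
  qed
  have ad: "p dvd a * d - 1"
    using B(1) c dvd_mult[of p c b] by (simp add: B_eq algebra_simps)
  have "mcong p B (Mat a b 0 d)"
    using c by (simp add: B_eq mcong_dvd)
  from eng_upper_triangular[OF this ad] eng
  have "psim p (upper (s * (d\<^sup>2 - 1) ^ Suc k)) 1"
    using psim_sym psim_trans by blast
  then have "p dvd s * (d\<^sup>2 - 1) ^ Suc k"
    using upper_in_verts[of "s * (d\<^sup>2 - 1) ^ Suc k"]
    by (auto simp: engel_verts_def simp del: power_Suc p_dvd_mult)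
  then have "p dvd d\<^sup>2 - 1"
    using s(1) prime_dvd_power[OF prime] p_dvd_mult by blast
  moreover have "d\<^sup>2 - 1 = (d - 1) * (d + 1)"
    by (simp add: algebra_simps power2_eq_square)
  ultimately consider "p dvd d - 1" | "p dvd d + 1"
    by auto
  then have "\<exists>t. psim p B (upper t)"
  proof cases
    case 1
    have "a - 1 = (a * d - 1) - a * (d - 1)"
      by (simp add: algebra_simps)
    then have "p dvd a - 1"
      using 1 ad by (metis dvd_diff dvd_mult)
    then have "mcong p B (upper b)"
      using 1 c by (simp add: B_eq upper_def mcong_dvd)
    then show ?thesis
      using mcong_imp_psim by blast
  next
    case 2
    have "a + 1 = - (a * d - 1) + a * (d + 1)"
      by (simp add: algebra_simps)
    then have "p dvd a + 1"
      using 2 ad by (metis dvd_add dvd_minus_iff dvd_mult)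
    then have "mcong p B (- upper (- b))"
      using 2 c by (simp add: B_eq upper_def mcong_dvd)
    then show ?thesis
      unfolding psim_def by blast
  qed
  then obtain t where t: "psim p B (upper t)" by blast
  moreover have "\<not> p dvd t"
  proof
    assume "p dvd t"
    then have "psim p (upper t) 1"
      by (simp add: upper_def one_mat2_def mcong_dvd mcong_imp_psim)
    then show False
      using t B(2) psim_trans by blast
  qed
  ultimately show ?thesis
    by (auto simp: parabolic_def)
qed

lemma reach_parabolic:
  "(A, B) \<in> (engel_arcs (Suc k))\<^sup>* \<Longrightarrow> A \<in> parabolic \<Longrightarrow> p dvd trace_pow2 k 11 \<Longrightarrow> B \<in> parabolic"
  by (induction rule: rtrancl_induct) (auto intro: parabolic_closed)

section \<open>The group PSL(2, p)\<close>

text \<open>Conjugation turns the upper left entry into 0. The commutator with diag(2, 1/2) is then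
  lower triangular with diagonal 4, 1/4, and its commutators with \<open>lower s\<close> fill the
  lower unipotent group.\<close>

lemma normal_subgroup_contains_lower:
  assumes mult: "\<And>A B. A \<in> N \<Longrightarrow> B \<in> N \<Longrightarrow> A * B \<in> N"
    and adj: "\<And>A. A \<in> N \<Longrightarrow> adj A \<in> N"
    and mconj: "\<And>A g. A \<in> N \<Longrightarrow> det g = 1 \<Longrightarrow> mconj g A \<in> N"
    and psim: "\<And>A B. A \<in> N \<Longrightarrow> psim p A B \<Longrightarrow> det B = 1 \<Longrightarrow> B \<in> N"
    and A: "A \<in> N" "A \<in> engel_verts"
  shows "lower r \<in> N"
proof -
  obtain g where g: "det g = 1" "\<not> p dvd e21 (mconj g A)"
    using conj_nonzero_corner[OF A(2)] by blast
  obtain a b c d where B: "mconj g A = Mat a b c d" by (cases "mconj g A")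
  have "Mat a b c d \<in> N" "det (Mat a b c d) = 1"
    using mconj[OF A(1) g(1)] A(2) g(1) unfolding B [symmetric] by (auto simp: engel_verts_def det_conj)
  obtain f where f: "p dvd c * f - 1"
    using inverse_mod[of c] g(2) by (auto simp: B)
  define C where "C = mconj (upper (a * f)) (Mat a b c d)"
  have C: "C \<in> N"
    unfolding C_def by (rule mconj) (fact, simp)
  obtain e b' t where C_eq: "C = Mat e b' c t" "p dvd e"
  proof
    have "a - a * f * c = - a * (c * f - 1)"
      by (simp add: algebra_simps)
    then show "p dvd a - a * f * c"
      using f by simp
    show "C = Mat (a - a * f * c) (e12 C) c (e22 C)"
      by (simp add: C_def mconj_def upper_def)
  qed
  have "det C = 1"
    using \<open>det (Mat a b c d) = 1\<close> by (simp only: C_def det_conj det_upper)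
  then have "b' * c + 1 = e * t"
    by (simp add: C_eq)
  then have b'c: "p dvd b' * c + 1"
    using C_eq by simp
  obtain h where h: "p dvd 2 * h - 1"
    using inverse_mod not_dvd_small[of 2] by auto
  then obtain D where D: "det D = 1" "mcong p D (Mat 2 0 0 h)"
    using lift_SL2[of 2 h 0 0] by auto
  define E where "E = D * C * adj D * adj C"
  have E: "E \<in> N"
    using mult[OF mconj[of C "adj D"] adj[of C]] C D(1) by (simp add: E_def mconj_def)
  define q where "q = h\<^sup>2"
  have q: "p dvd 4 * q - 1"
  proof -
    have "4 * q - 1 = (2 * h - 1) * (2 * h + 1)"
      by (simp add: q_def algebra_simps power2_eq_square)
    then show ?thesis using h by simp
  qed
  obtain y where y: "mcong p E (Mat 4 0 y q)"
  proof
    let ?y = "h * c * h * t - h * t * 2 * c"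
    have "mcong p C (Mat 0 b' c t)"
      using C_eq by (simp add: mcong_dvd)
    then have "mcong p E (Mat 2 0 0 h * Mat 0 b' c t * adj (Mat 2 0 0 h) * adj (Mat 0 b' c t))"
      unfolding E_def using D(2) by (intro mcong_mult mcong_adj)
    also have "\<dots> = Mat (- 4 * (b' * c)) 0 ?y (- q * (b' * c))"
      by (simp add: q_def power2_eq_square)
    also have "mcong p \<dots> (Mat 4 0 ?y q)"
    proof -
      have eqs: "- 4 * (b' * c) - 4 = - 4 * (b' * c + 1)" "- q * (b' * c) - q = - q * (b' * c + 1)"
        by (simp_all add: algebra_simps)
      then show ?thesis
        unfolding mcong_dvd eqs by (intro conjI dvd_mult b'c) simp_all
    qed
    finally show "mcong p E (Mat 4 0 ?y q)" .
  qed
  have "\<not> p dvd 3 * 5"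
    unfolding p_dvd_mult using not_dvd_small[of 3] not_dvd_small[of 5] by simp
  then obtain i where i: "p dvd 15 * i - 1"
    using inverse_mod[of "3 * 5"] by auto
  \<comment> \<open>The last commutator has parameter s (q^2 - 1) with q = 1/4, that is, -15 s/16;
    so s = -16 r/15.\<close>
  define s where "s = - 16 * i * r"
  define F where "F = E * (lower s * adj E * lower (- s))"
  have "lower s = adj (lower (- s))"
    by (simp add: lower_def)
  then have F: "F \<in> N"
    using mult[OF E mconj[OF adj[OF E], of "lower (- s)"]] by (simp add: F_def mconj_def)
  have "mcong p F (Mat 4 0 y q * (lower s * adj (Mat 4 0 y q) * lower (- s)))"
    unfolding F_def by (intro mcong_mult mcong_adj y mcong_refl)
  also have "Mat 4 0 y q * (lower s * adj (Mat 4 0 y q) * lower (- s)) =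
      Mat (4 * q) 0 (s * (q\<^sup>2 - 4 * q)) (4 * q)"
    by (simp add: lower_def algebra_simps power2_eq_square)
  also have "mcong p \<dots> (lower r)"
  proof -
    have "s * (q\<^sup>2 - 4 * q) - r = - i * r * (4 * q - 1) * (4 * q + 1) + 16 * i * r * (4 * q - 1)
        + r * (15 * i - 1)"
      by (simp add: s_def algebra_simps power2_eq_square)
    then have "p dvd s * (q\<^sup>2 - 4 * q) - r"
      using q i by (metis dvd_add dvd_mult dvd_mult2)
    then show ?thesis
      using q by (simp add: lower_def mcong_dvd)
  qed
  finally show ?thesis
    using psim[OF F] by (simp add: mcong_imp_psim)
qed

lemma normal_subgroup_all:
  assumes mult: "\<And>A B. A \<in> N \<Longrightarrow> B \<in> N \<Longrightarrow> A * B \<in> N"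
    and adj: "\<And>A. A \<in> N \<Longrightarrow> adj A \<in> N"
    and mconj: "\<And>A g. A \<in> N \<Longrightarrow> det g = 1 \<Longrightarrow> mconj g A \<in> N"
    and psim: "\<And>A B. A \<in> N \<Longrightarrow> psim p A B \<Longrightarrow> det B = 1 \<Longrightarrow> B \<in> N"
    and A: "A \<in> N" "A \<in> engel_verts"
    and M: "det M = 1"
  shows "M \<in> N"
proof -
  have lower: "lower r \<in> N" for r
    by (rule normal_subgroup_contains_lower[of N A]) (fact assms)+
  have upper: "upper r \<in> N" for r
  proof -
    have "mconj (Mat 0 (- 1) 1 0) (lower (- r)) = upper r"
      by (simp add: mconj_def lower_def upper_def)
    then show ?thesis
      using mconj[of "lower (- r)" "Mat 0 (- 1) 1 0"] lower by simp
  qed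
  obtain a b c d where M_eq: "M = Mat a b c d" by (cases M)
  then obtain x y z w where "mcong p M (upper x * lower y * upper z * lower w)"
    using generation[of a d b c] M by auto
  then show ?thesis
    using psim[of "upper x * lower y * upper z * lower w" M] M
    by (auto intro: mult upper lower mcong_imp_psim mcong_sym)
qed

end

text \<open>
  Classes of matrices modulo $p$ and up to sign are coded by natural numbers, because the theorem
  asks for a group on that type.
\<close>

definition class_code :: "int \<Rightarrow> mat2 \<Rightarrow> nat" where
  "class_code p A = (LEAST k. psim p A (from_nat k))"

lemma psim_class_code: "psim p A (from_nat (class_code p A))"
  unfolding class_code_def by (rule LeastI[of _ "to_nat A"]) simp

lemma class_code_eq_iff: "class_code p A = class_code p B \<longleftrightarrow> psim p A B"
proof
  assume "class_code p A = class_code p B"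
  then show "psim p A B"
    using psim_class_code psim_sym psim_trans by metis
next
  assume "psim p A B"
  then have "psim p A = psim p B"
    using psim_sym psim_trans by blast
  then show "class_code p A = class_code p B"
    by (simp add: class_code_def)
qed

text \<open>Products are formed on decoded representatives; these agree with the original matrices
  up to sign modulo \<open>p\<close>, but need not have determinant exactly 1.\<close>

definition PSL2 :: "int \<Rightarrow> nat monoid" where
  "PSL2 p = \<lparr>carrier = class_code p ` {A. det A = 1},
     monoid.mult = (\<lambda>x y. class_code p (from_nat x * from_nat y)),
     one = class_code p 1\<rparr>"

lemma carrier_PSL2: "carrier (PSL2 p) = class_code p ` {A. det A = 1}"
  and one_PSL2: "\<one>\<^bsub>PSL2 p\<^esub> = class_code p 1"
  by (simp_all add: PSL2_def)

lemma mult_PSL2: "class_code p A \<otimes>\<^bsub>PSL2 p\<^esub> class_code p B = class_code p (A * B)"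
  by (simp add: PSL2_def class_code_eq_iff psim_mult psim_class_code psim_sym)

lemma group_PSL2: "group (PSL2 p)"
proof (rule groupI)
  fix x y z
  assume "x \<in> carrier (PSL2 p)" "y \<in> carrier (PSL2 p)"
  then show "x \<otimes>\<^bsub>PSL2 p\<^esub> y \<in> carrier (PSL2 p)"
    by (auto simp: carrier_PSL2 mult_PSL2 det_mult)
  assume "z \<in> carrier (PSL2 p)"
  with \<open>x \<in> _\<close> \<open>y \<in> _\<close>
  show "x \<otimes>\<^bsub>PSL2 p\<^esub> y \<otimes>\<^bsub>PSL2 p\<^esub> z = x \<otimes>\<^bsub>PSL2 p\<^esub> (y \<otimes>\<^bsub>PSL2 p\<^esub> z)"
    by (auto simp: carrier_PSL2 mult_PSL2 mult.assoc)
next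
  fix x
  assume "x \<in> carrier (PSL2 p)"
  then obtain A where A: "x = class_code p A" "det A = 1"
    by (auto simp: carrier_PSL2)
  then show "\<one>\<^bsub>PSL2 p\<^esub> \<otimes>\<^bsub>PSL2 p\<^esub> x = x"
    by (simp add: one_PSL2 mult_PSL2)
  have "class_code p (adj A) \<otimes>\<^bsub>PSL2 p\<^esub> x = \<one>\<^bsub>PSL2 p\<^esub>"
    by (simp add: A mult_PSL2 one_PSL2 adj_cancel)
  then show "\<exists>y\<in>carrier (PSL2 p). y \<otimes>\<^bsub>PSL2 p\<^esub> x = \<one>\<^bsub>PSL2 p\<^esub>"
    using A(2) by (intro bexI[of _ "class_code p (adj A)"]) (auto simp: carrier_PSL2)
qed (auto simp: carrier_PSL2 one_PSL2)

lemma inv_PSL2: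
  assumes "det A = 1"
  shows "inv\<^bsub>PSL2 p\<^esub> class_code p A = class_code p (adj A)"
  using assms
  by (intro group.inv_equality[OF group_PSL2])
    (auto simp: mult_PSL2 one_PSL2 adj_cancel carrier_PSL2)

lemma engel_commutator_PSL2:
  assumes "det A = 1" "det B = 1"
  shows "engel_commutator (PSL2 p) k (class_code p A) (class_code p B) = class_code p (eng k A B)"
  by (induction k) (simp_all add: commutator_def inv_PSL2 mult_PSL2 comm_def det_eng assms)

lemma finite_PSL2:
  assumes "p > 0"
  shows "finite (carrier (PSL2 p))"
proof (rule finite_subset)
  show "carrier (PSL2 p) \<subseteq> (\<lambda>(a, b, c, d). class_code p (Mat a b c d)) `
      ({0..<p} \<times> {0..<p} \<times> {0..<p} \<times> {0..<p})"
  proof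
    fix x
    assume "x \<in> carrier (PSL2 p)"
    then obtain a b c d where "x = class_code p (Mat a b c d)"
      by (metis carrier_PSL2 imageE mat2.exhaust)
    also have "\<dots> = class_code p (Mat (a mod p) (b mod p) (c mod p) (d mod p))"
      by (simp add: class_code_eq_iff psim_def mcong_def)
    finally show "x \<in> (\<lambda>(a, b, c, d). class_code p (Mat a b c d)) `
        ({0..<p} \<times> {0..<p} \<times> {0..<p} \<times> {0..<p})"
      using assms by (auto intro!: image_eqI[where x = "(a mod p, b mod p, c mod p, d mod p)"])
  qed
qed auto

context prime_3_mod_4
begin

section \<open>Transfer to the Engel graph of the group\<close>

lemma engel_universal_PSL2:
  assumes "k \<ge> 1"
  shows "carrier (PSL2 p) - engel_universal (PSL2 p) k = class_code p ` engel_verts"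
proof -
  have "class_code p A \<in> engel_universal (PSL2 p) k \<longleftrightarrow> A \<notin> engel_verts" if A: "det A = 1" for A
  proof
    assume "class_code p A \<in> engel_universal (PSL2 p) k"
    then have "psim p (eng k A X) 1" if "det X = 1" for X
      using that A
      by (auto simp: engel_universal_def carrier_PSL2 engel_commutator_PSL2 one_PSL2 class_code_eq_iff)
    then show "A \<notin> engel_verts"
      using not_engel_universal by blast
  next
    assume "A \<notin> engel_verts"
    then have 1: "psim p A 1"
      using A by (simp add: engel_verts_def)
    have "psim p (eng k A X) 1 \<and> psim p (eng k X A) 1" if X: "det X = 1" for X
    proof
      show "psim p (eng k A X) 1"
        by (rule psim_eng_mono[of X p 0 A k]) (simp_all add: X 1)
      have "psim p (comm X A) (comm X 1)"
        by (intro psim_comm psim_refl 1)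
      then show "psim p (eng k X A) 1"
        using A X assms by (intro psim_eng_mono[of A p 1 X k]) (simp_all add: comm_def adj_cancel)
    qed
    then show "class_code p A \<in> engel_universal (PSL2 p) k"
      using A by (auto simp: engel_universal_def carrier_PSL2 engel_commutator_PSL2 one_PSL2 class_code_eq_iff)
  qed
  then show ?thesis
    by (auto simp: carrier_PSL2 engel_verts_def)
qed

lemma engel_graph_PSL2:
  assumes "k \<ge> 1"
  shows "pverts (engel_graph (PSL2 p) k) = class_code p ` engel_verts"
    and "A \<in> engel_verts \<Longrightarrow> B \<in> engel_verts \<Longrightarrow>
      (class_code p A, class_code p B) \<in> parcs (engel_graph (PSL2 p) k) \<longleftrightarrow> (A, B) \<in> engel_arcs k"
  using assms
  by (auto simp: engel_graph_def engel_universal_PSL2 engel_arcs_def engel_verts_def engel_commutator_PSL2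
      one_PSL2 class_code_eq_iff)

lemma reachable_PSL2:
  assumes "(A, B) \<in> (engel_arcs k)\<^sup>*" "A \<in> engel_verts" "k \<ge> 1"
  shows "class_code p A \<rightarrow>\<^sup>*\<^bsub>with_proj (engel_graph (PSL2 p) k)\<^esub> class_code p B"
  using assms(1)
proof (induction rule: rtrancl_induct)
  case base
  show ?case
    using assms by (auto simp: reachable_def engel_graph_PSL2)
next
  case (step B C)
  then have "B \<in> engel_verts" "C \<in> engel_verts"
    by (auto simp: engel_arcs_def)
  with step assms show ?case
    unfolding reachable_def
    by (intro rtrancl_on_into_rtrancl_on[OF step.IH[unfolded reachable_def]])
       (auto simp: engel_graph_PSL2)
qed

lemma reachable_PSL2_imp:
  assumes "class_code p A \<rightarrow>\<^sup>*\<^bsub>with_proj (engel_graph (PSL2 p) k)\<^esub> y" "A \<in> engel_verts" "k \<ge> 1"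
  shows "\<exists>B\<in>engel_verts. y = class_code p B \<and> (A, B) \<in> (engel_arcs k)\<^sup>*"
  using assms(1) unfolding reachable_def
proof (induction rule: rtrancl_on_induct)
  case base
  show ?case using assms(2) by blast
next
  case (step y z)
  then obtain B C where "B \<in> engel_verts" "y = class_code p B" "(A, B) \<in> (engel_arcs k)\<^sup>*"
    "C \<in> engel_verts" "z = class_code p C"
    using assms(3) by (auto simp: engel_graph_PSL2)
  moreover from this have "(B, C) \<in> engel_arcs k"
    using step assms(3) by (simp add: engel_graph_PSL2)
  ultimately show ?case
    by (blast intro: rtrancl_into_rtrancl)
qed

lemma strongly_connected_PSL2:
  assumes "p dvd trace_pow2 k 11"
  shows "strongly_connected_digraph (with_proj (engel_graph (PSL2 p) (k + 2)))"
proof -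
  have "(A, B) \<in> (engel_arcs (k + 2))\<^sup>*" if "A \<in> engel_verts" "B \<in> engel_verts" for A B
    using all_linked[OF that(1) assms] all_linked[OF that(2) assms] by (auto simp: link_def)
  then show ?thesis
    using engel_graph_PSL2(1)[of "k + 2"] reachable_PSL2[of _ _ "k + 2"]
    by (auto simp: strongly_connected_digraph_def)
qed

lemma not_strongly_connected_PSL2:
  assumes "p dvd trace_pow2 k 11"
  shows "\<not> strongly_connected_digraph (with_proj (engel_graph (PSL2 p) (Suc k)))"
proof
  define w where "w = Mat 0 (- 1) 1 0"
  have w: "w \<in> engel_verts"
    by (rule involution_in_verts) (simp_all add: w_def)
  have u: "upper 1 \<in> engel_verts"
    by (rule upper_in_verts) simp
  assume "strongly_connected_digraph (with_proj (engel_graph (PSL2 p) (Suc k)))"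
  then have "class_code p (upper 1) \<rightarrow>\<^sup>*\<^bsub>with_proj (engel_graph (PSL2 p) (Suc k))\<^esub> class_code p w"
    using u w by (simp add: strongly_connected_digraph_def engel_graph_PSL2)
  then obtain B where B: "class_code p w = class_code p B" "(upper 1, B) \<in> (engel_arcs (Suc k))\<^sup>*"
    using reachable_PSL2_imp u by force
  have "upper 1 \<in> parabolic"
    unfolding parabolic_def by (intro CollectI exI[of _ 1]) simp
  then have "B \<in> parabolic"
    using reach_parabolic B(2) assms by blast
  then obtain s where "psim p w (upper s)"
    using B(1) psim_trans unfolding class_code_eq_iff parabolic_def by blast
  then show False
    by (simp add: w_def psim_def upper_def mcong_dvd)
qed

lemma simple_PSL2: "simple_group (PSL2 p)"
proof (intro simple_group.intro simple_group_axioms.intro)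
  show "group (PSL2 p)"
    by (rule group_PSL2)
  have u: "upper 1 \<in> engel_verts"
    by (rule upper_in_verts) simp
  have "{class_code p 1, class_code p (upper 1)} \<subseteq> carrier (PSL2 p)"
    by (auto simp: carrier_PSL2)
  moreover have "class_code p 1 \<noteq> class_code p (upper 1)"
    using u psim_sym by (auto simp: engel_verts_def class_code_eq_iff)
  ultimately have "2 \<le> card (carrier (PSL2 p))"
    using card_mono[OF finite_PSL2[of p], of "{class_code p 1, class_code p (upper 1)}"] gt_5
    by simp
  then show "1 < order (PSL2 p)"
    by (simp add: order_def)
next
  fix H
  assume "H \<lhd> PSL2 p"
  then interpret normal H "PSL2 p" .
  \<comment> \<open>The preimage of \<open>H\<close> in SL(2, Z), where the generation argument
    takes place.\<close>
  define N where "N = {A. det A = 1 \<and> class_code p A \<in> H}"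
  have sub: "H \<subseteq> carrier (PSL2 p)"
    by (rule subset)
  show "H = carrier (PSL2 p) \<or> H = {\<one>\<^bsub>PSL2 p\<^esub>}"
  proof (cases "N \<inter> engel_verts = {}")
    case True
    have "x = \<one>\<^bsub>PSL2 p\<^esub>" if "x \<in> H" for x
    proof -
      obtain A where A: "x = class_code p A" "det A = 1"
        using sub \<open>x \<in> H\<close> by (auto simp: carrier_PSL2)
      with \<open>x \<in> H\<close> True have "psim p A 1"
        by (auto simp: N_def engel_verts_def)
      then show ?thesis
        by (simp add: A(1) one_PSL2 class_code_eq_iff)
    qed
    then have "H \<subseteq> {\<one>\<^bsub>PSL2 p\<^esub>}"
      by auto
    with subgroup.one_closed[OF subgroup_axioms] show ?thesis
      by auto
  next
    case False
    then obtain A where A: "A \<in> N" "A \<in> engel_verts" by blast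
    have "M \<in> N" if "det M = 1" for M
    proof (rule normal_subgroup_all[OF _ _ _ _ A that])
      show "A * B \<in> N" if "A \<in> N" "B \<in> N" for A B
        using that subgroup.m_closed[OF subgroup_axioms, of "class_code p A" "class_code p B"]
        by (simp add: N_def mult_PSL2 det_mult)
      show "adj A \<in> N" if "A \<in> N" for A
        using that m_inv_closed[of "class_code p A"] by (simp add: N_def inv_PSL2)
      show "mconj g A \<in> N" if "A \<in> N" "det g = 1" for A g
        using that inv_op_closed1[of "class_code p g" "class_code p A"]
        by (simp add: N_def inv_PSL2 mult_PSL2 mconj_def carrier_PSL2 det_mult)
      show "B \<in> N" if "A \<in> N" "psim p A B" "det B = 1" for A B
        using that by (simp add: N_def flip: class_code_eq_iff)
    qed
    then have "carrier (PSL2 p) \<subseteq> H"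
      by (auto simp: carrier_PSL2 N_def)
    then show ?thesis
      using sub by blast
  qed
qed

lemma non_abelian_PSL2: "\<not> comm_group (PSL2 p)"
proof
  assume "comm_group (PSL2 p)"
  then have "class_code p (upper 1) \<otimes>\<^bsub>PSL2 p\<^esub> class_code p (lower 1) =
      class_code p (lower 1) \<otimes>\<^bsub>PSL2 p\<^esub> class_code p (upper 1)"
    by (intro comm_monoid.m_comm) (auto simp: comm_group_def carrier_PSL2)
  then show False
    using not_dvd_small[of 2]
    by (auto simp: mult_PSL2 class_code_eq_iff psim_def upper_def lower_def mcong_dvd)
qed

end

theorem mainTheorem6:
  fixes n :: nat
  assumes "n \<ge> 1"
  shows "\<exists>G :: nat monoid.
           simple_group G \<and> finite (carrier G) \<and> \<not> comm_group G \<and>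
           strongly_connected_digraph (with_proj (engel_graph G (n + 1))) \<and>
           \<not> strongly_connected_digraph (with_proj (engel_graph G n))"
proof -
  obtain k where n: "n = Suc k"
    using assms by (cases n) auto
  obtain p :: int where p: "prime p" "p mod 4 = 3" "p > 5" "p dvd trace_pow2 k 11"
    using exists_suitable_prime by blast
  interpret prime_3_mod_4 p
    by unfold_locales (fact p)+
  have "finite (carrier (PSL2 p))"
    using p(3) by (intro finite_PSL2) simp
  then show ?thesis
    using simple_PSL2 non_abelian_PSL2 strongly_connected_PSL2[OF p(4)]
      not_strongly_connected_PSL2[OF p(4)]
    by (intro exI[of _ "PSL2 p"]) (simp add: n)
qed

end
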